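(* Let $S$ be a system specified by $(\Pi_S,\mathcal{T}_S,T_S)$, where $\Pi_S=(\Sigma_S,\mathsf{Pred})$ and $T_S=(V,\Sigma,\mathsf{Init},\mathsf{Update})$. Assume that $\Sigma=\emptyset$, i.e. $\mathsf{Update}(\overline{x},\overline{x}')$ describes updates of the variables in $V$ only. Let $\mathsf{Init}$ and $\Phi$ be arbitrary $\Pi_S$-formulae and $\mathsf{Update}$ an arbitrary formula over $\Pi_S$ extended with the constants $V'$. Assume that $\mathcal{T}_S$ is the extension with additional free constants of a theory $\mathcal{T}_0$ with signature $(\Sigma_0,\mathsf{Pred})$ which allows quantifier elimination, i.e. $\Sigma_S$ is the disjoint union of $\Sigma_0$, a set $\Sigma_P$ of parametric constants, and a set $\Sigma_n$ of the remaining non-parametric additional constants. Then: (a) checking whether $\Phi$ is an inductive invariant is decidable; (b) a method for quantifier elimination in $\mathcal{T}_0$ can be used to effectively construct a weakest condition $\overline{\Gamma}$ on the parameters in $\Sigma_P$ under which $\Phi$ is an inductive invariant.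
   Context: A transition constraint system $T_S=(V,\Sigma,\mathsf{Init},\mathsf{Update})$ consists of a set $V$ of variables (constants) and a set $\Sigma$ of function symbols whose values change, a formula $\mathsf{Init}$ describing initial states, and a formula $\mathsf{Update}$ relating the values of symbols before a transition ($V,\Sigma$) and after it (primed copies $V',\Sigma'$). For a formula $\Phi$, $\Phi'$ is obtained by replacing every symbol of $V\cup\Sigma$ by its primed copy. For a formula $\Gamma$ over the parameters, $\Phi$ is an inductive invariant under $\Gamma$ iff $\mathcal{T}_S\wedge\Gamma\wedge\mathsf{Init}\wedge\neg\Phi\models\perp$ and $\mathcal{T}_S\wedge\Gamma\wedge\Phi\wedge\mathsf{Update}\wedge\neg\Phi'\models\perp$. A formula $\overline{\Gamma}$ over the parameters is a weakest condition under which $\Phi$ is an inductive invariant iff for every formula $\Gamma$ expressing constraints on the parameters, $\Phi$ is an inductive invariant under $\Gamma$ iff $\mathcal{T}_S\cup\Gamma\models\overline{\Gamma}$. A theory allows quantifier elimination if every formula is equivalent modulo the theory to a quantifier-free formula in the same signature.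
   Formalization: For (a), quantifier elimination must be computable and quantifier-free T_0-validity decidable (else (a) is false); Σ_P, Σ_n and V are decidable sets. All may be relative to an oracle. Languages are countable; consequence is over models inside one type (ordinary if infinite). *)

theory Defs
  imports "HOL-Library.Nat_Bijection"
begin

section \<open>First-order logic with equality\<close>

text \<open>
  Symbol names are natural numbers, and \<open>Prime c\<close> is the primed copy of \<open>Sym c\<close>.
  A symbol is a name together with an arity, so that a function signature is a set of pairs
  (name, arity) and a constant \<open>c\<close> is the pair \<open>(c, 0)\<close>.
\<close>

datatype sym = Sym nat | Prime nat

datatype tm = Var nat | Fn sym "tm list"

datatype fm = Fls | Eq tm tm | Pre nat "tm list" | Imp fm fm | All nat fm

abbreviation Neg :: "fm \<Rightarrow> fm" where "Neg \<phi> \<equiv> Imp \<phi> Fls"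
abbreviation Tru :: fm where "Tru \<equiv> Neg Fls"
abbreviation Conj :: "fm \<Rightarrow> fm \<Rightarrow> fm" where "Conj \<phi> \<psi> \<equiv> Neg (Imp \<phi> (Neg \<psi>))"
abbreviation Iff :: "fm \<Rightarrow> fm \<Rightarrow> fm" where "Iff \<phi> \<psi> \<equiv> Conj (Imp \<phi> \<psi>) (Imp \<psi> \<phi>)"

type_synonym signature = "(sym \<times> nat) set \<times> (nat \<times> nat) set"

fun wf_tm :: "(sym \<times> nat) set \<Rightarrow> tm \<Rightarrow> bool" where
  "wf_tm F (Var x) = True"
| "wf_tm F (Fn f ts) = ((f, length ts) \<in> F \<and> (\<forall>t \<in> set ts. wf_tm F t))"

fun formula :: "signature \<Rightarrow> fm \<Rightarrow> bool" where
  "formula \<Pi> Fls = True"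
| "formula \<Pi> (Eq s t) = (wf_tm (fst \<Pi>) s \<and> wf_tm (fst \<Pi>) t)"
| "formula \<Pi> (Pre p ts) = ((p, length ts) \<in> snd \<Pi> \<and> (\<forall>t \<in> set ts. wf_tm (fst \<Pi>) t))"
| "formula \<Pi> (Imp \<phi> \<psi>) = (formula \<Pi> \<phi> \<and> formula \<Pi> \<psi>)"
| "formula \<Pi> (All x \<phi>) = formula \<Pi> \<phi>"

fun fv_tm :: "tm \<Rightarrow> nat set" where
  "fv_tm (Var x) = {x}"
| "fv_tm (Fn f ts) = (\<Union>t \<in> set ts. fv_tm t)"

fun fv :: "fm \<Rightarrow> nat set" where
  "fv Fls = {}"
| "fv (Eq s t) = fv_tm s \<union> fv_tm t"
| "fv (Pre p ts) = (\<Union>t \<in> set ts. fv_tm t)"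
| "fv (Imp \<phi> \<psi>) = fv \<phi> \<union> fv \<psi>"
| "fv (All x \<phi>) = fv \<phi> - {x}"

definition sentence :: "signature \<Rightarrow> fm \<Rightarrow> bool" where
  "sentence \<Pi> \<phi> \<longleftrightarrow> formula \<Pi> \<phi> \<and> fv \<phi> = {}"

fun qfree :: "fm \<Rightarrow> bool" where
  "qfree (All x \<phi>) = False"
| "qfree (Imp \<phi> \<psi>) = (qfree \<phi> \<and> qfree \<psi>)"
| "qfree _ = True"

text \<open>
  The universe of a structure is an arbitrary nonempty subset of a type \<open>'a\<close>. Languages are
  countable, so by the Loewenheim--Skolem theorem \<open>entails TYPE('a)\<close> is ordinary first-order
  consequence for every infinite \<open>'a\<close>.
\<close>

record 'a struct =
  univ :: "'a set"
  func :: "sym \<Rightarrow> 'a list \<Rightarrow> 'a"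
  pred :: "nat \<Rightarrow> 'a list \<Rightarrow> bool"

definition is_struct :: "signature \<Rightarrow> 'a struct \<Rightarrow> bool" where
  "is_struct \<Pi> M \<longleftrightarrow> univ M \<noteq> {} \<and>
    (\<forall>(f, n) \<in> fst \<Pi>. \<forall>xs. length xs = n \<and> set xs \<subseteq> univ M \<longrightarrow> func M f xs \<in> univ M)"

fun val :: "'a struct \<Rightarrow> (nat \<Rightarrow> 'a) \<Rightarrow> tm \<Rightarrow> 'a" where
  "val M e (Var x) = e x"
| "val M e (Fn f ts) = func M f (map (val M e) ts)"

fun sat :: "'a struct \<Rightarrow> (nat \<Rightarrow> 'a) \<Rightarrow> fm \<Rightarrow> bool" where
  "sat M e Fls = False"
| "sat M e (Eq s t) = (val M e s = val M e t)"
| "sat M e (Pre p ts) = pred M p (map (val M e) ts)"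
| "sat M e (Imp \<phi> \<psi>) = (sat M e \<phi> \<longrightarrow> sat M e \<psi>)"
| "sat M e (All x \<phi>) = (\<forall>a \<in> univ M. sat M (e(x := a)) \<phi>)"

definition entails :: "'a itself \<Rightarrow> signature \<Rightarrow> fm set \<Rightarrow> fm \<Rightarrow> bool" where
  "entails _ \<Pi> T \<phi> \<longleftrightarrow> (\<forall>(M :: 'a struct) e.
     is_struct \<Pi> M \<and> range e \<subseteq> univ M \<and> (\<forall>\<psi> \<in> T. sat M e \<psi>) \<longrightarrow> sat M e \<phi>)"

definition is_theory :: "signature \<Rightarrow> fm set \<Rightarrow> bool" where
  "is_theory \<Pi> T \<longleftrightarrow> (\<forall>\<phi> \<in> T. sentence \<Pi> \<phi>)"

text \<open>
  By choice, \<open>T\<close> allows quantifier elimination iff it has a method \<open>qe\<close> in this sense.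
  The formula \<open>qe \<phi>\<close> is not required to have its free variables among those of \<open>\<phi>\<close>.
\<close>

definition qe_method :: "'a itself \<Rightarrow> signature \<Rightarrow> fm set \<Rightarrow> (fm \<Rightarrow> fm) \<Rightarrow> bool" where
  "qe_method I \<Pi> T qe \<longleftrightarrow> (\<forall>\<phi>. formula \<Pi> \<phi> \<longrightarrow>
     formula \<Pi> (qe \<phi>) \<and> qfree (qe \<phi>) \<and> entails I \<Pi> T (Iff \<phi> (qe \<phi>)))"

section \<open>Transition constraint systems\<close>

definition unprimed :: "(nat \<times> nat) set \<Rightarrow> (sym \<times> nat) set" where
  "unprimed F = (\<lambda>(f, n). (Sym f, n)) ` F"

definition primed :: "(nat \<times> nat) set \<Rightarrow> (sym \<times> nat) set" where
  "primed F = (\<lambda>(f, n). (Prime f, n)) ` F"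

definition constants :: "nat set \<Rightarrow> (nat \<times> nat) set" where
  "constants C = C \<times> {0}"

text \<open>
  The components are \<open>\<Sigma>\<^sub>S\<close>, \<open>Pred\<close>, the axioms of \<open>T\<^sub>S\<close>, \<open>V\<close>, \<open>\<Sigma>\<close>, \<open>Init\<close> and \<open>Update\<close>.
\<close>

record system =
  symbols :: "(nat \<times> nat) set"
  predicates :: "(nat \<times> nat) set"
  thy_axioms :: "fm set"
  variables :: "nat set"
  fun_symbols :: "(nat \<times> nat) set"
  init :: fm
  update :: fm

definition changing :: "system \<Rightarrow> (nat \<times> nat) set" where
  "changing S = constants (variables S) \<union> fun_symbols S"

definition state_sig :: "system \<Rightarrow> signature" where
  "state_sig S = (unprimed (symbols S), predicates S)"

definition trans_sig :: "system \<Rightarrow> signature" where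
  "trans_sig S = (unprimed (symbols S) \<union> primed (changing S), predicates S)"

definition wf_system :: "system \<Rightarrow> bool" where
  "wf_system S \<longleftrightarrow> is_theory (state_sig S) (thy_axioms S) \<and> changing S \<subseteq> symbols S \<and>
     formula (state_sig S) (init S) \<and> formula (trans_sig S) (update S)"

fun prime_sym :: "(nat \<times> nat) set \<Rightarrow> sym \<Rightarrow> nat \<Rightarrow> sym" where
  "prime_sym X (Sym f) n = (if (f, n) \<in> X then Prime f else Sym f)"
| "prime_sym X (Prime f) n = Prime f"

fun prime_tm :: "(nat \<times> nat) set \<Rightarrow> tm \<Rightarrow> tm" where
  "prime_tm X (Var x) = Var x"
| "prime_tm X (Fn f ts) = Fn (prime_sym X f (length ts)) (map (prime_tm X) ts)"

fun prime_fm :: "(nat \<times> nat) set \<Rightarrow> fm \<Rightarrow> fm" where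
  "prime_fm X Fls = Fls"
| "prime_fm X (Eq s t) = Eq (prime_tm X s) (prime_tm X t)"
| "prime_fm X (Pre p ts) = Pre p (map (prime_tm X) ts)"
| "prime_fm X (Imp \<phi> \<psi>) = Imp (prime_fm X \<phi>) (prime_fm X \<psi>)"
| "prime_fm X (All x \<phi>) = All x (prime_fm X \<phi>)"

text \<open>
  \<open>Init\<close>, \<open>Update\<close> and \<open>\<Phi>\<close> may contain free logical variables. These are read under one common
  assignment, that is, as further constants which do not change.
\<close>

definition inductive_invariant_under :: "'a itself \<Rightarrow> system \<Rightarrow> fm \<Rightarrow> fm \<Rightarrow> bool" where
  "inductive_invariant_under I S \<Gamma> \<Phi> \<longleftrightarrow>
     entails I (state_sig S) (thy_axioms S \<union> {\<Gamma>, init S, Neg \<Phi>}) Fls \<and>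
     entails I (trans_sig S)
       (thy_axioms S \<union> {\<Gamma>, \<Phi>, update S, Neg (prime_fm (changing S) \<Phi>)}) Fls"

definition inductive_invariant :: "'a itself \<Rightarrow> system \<Rightarrow> fm \<Rightarrow> bool" where
  "inductive_invariant I S \<Phi> \<longleftrightarrow> inductive_invariant_under I S Tru \<Phi>"

text \<open>\<open>\<Pi>P\<close> is the signature of the constraints on the parameters.\<close>

definition weakest_condition :: "'a itself \<Rightarrow> signature \<Rightarrow> system \<Rightarrow> fm \<Rightarrow> fm \<Rightarrow> bool" where
  "weakest_condition I \<Pi>P S \<Phi> \<Gamma>' \<longleftrightarrow> sentence \<Pi>P \<Gamma>' \<and>
     (\<forall>\<Gamma>. sentence \<Pi>P \<Gamma> \<longrightarrow>
        (inductive_invariant_under I S \<Gamma> \<Phi> \<longleftrightarrow>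
         entails I (state_sig S) (thy_axioms S \<union> {\<Gamma>}) \<Gamma>'))"

section \<open>Computability\<close>

text \<open>
  The total functions recursive relative to a set \<open>Or\<close> of oracles; for \<open>Or = {}\<close> these are the
  total recursive functions. Minimization is only applied to total functions which have a
  zero everywhere; by the Kleene normal form theorem this yields all total recursive functions.
  Functions of several arguments are represented with the Cantor pairing function.
\<close>

inductive recursive_in :: "(nat \<Rightarrow> nat) set \<Rightarrow> (nat \<Rightarrow> nat) \<Rightarrow> bool" for Or where
  zero: "recursive_in Or (\<lambda>x. 0)"
| suc: "recursive_in Or Suc"
| left: "recursive_in Or (\<lambda>x. fst (prod_decode x))"
| right: "recursive_in Or (\<lambda>x. snd (prod_decode x))"
| query: "h \<in> Or \<Longrightarrow> recursive_in Or h"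
| comp: "recursive_in Or f \<Longrightarrow> recursive_in Or g \<Longrightarrow> recursive_in Or (\<lambda>x. f (g x))"
| pair: "recursive_in Or f \<Longrightarrow> recursive_in Or g \<Longrightarrow>
    recursive_in Or (\<lambda>x. prod_encode (f x, g x))"
| prim_rec: "recursive_in Or f \<Longrightarrow> recursive_in Or g \<Longrightarrow>
    recursive_in Or (\<lambda>x. case prod_decode x of (n, y) \<Rightarrow>
      rec_nat (f y) (\<lambda>k r. g (prod_encode (k, prod_encode (r, y)))) n)"
| minim: "recursive_in Or f \<Longrightarrow> (\<forall>x. \<exists>k. f (prod_encode (k, x)) = 0) \<Longrightarrow>
    recursive_in Or (\<lambda>x. LEAST k. f (prod_encode (k, x)) = 0)"

definition computable_on ::
    "(nat \<Rightarrow> nat) set \<Rightarrow> ('x \<Rightarrow> nat) \<Rightarrow> ('y \<Rightarrow> nat) \<Rightarrow> 'x set \<Rightarrow> ('x \<Rightarrow> 'y) \<Rightarrow> bool" where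
  "computable_on Or c d D F \<longleftrightarrow>
     (\<exists>f. recursive_in Or f \<and> (\<forall>x \<in> D. f (c x) = d (F x)))"

definition decidable_on ::
    "(nat \<Rightarrow> nat) set \<Rightarrow> ('x \<Rightarrow> nat) \<Rightarrow> 'x set \<Rightarrow> ('x \<Rightarrow> bool) \<Rightarrow> bool" where
  "decidable_on Or c D P \<longleftrightarrow> computable_on Or c of_bool D P"

abbreviation decidable_set :: "(nat \<Rightarrow> nat) set \<Rightarrow> nat set \<Rightarrow> bool" where
  "decidable_set Or A \<equiv> decidable_on Or id UNIV (\<lambda>x. x \<in> A)"

fun sym_code :: "sym \<Rightarrow> nat" where
  "sym_code (Sym c) = prod_encode (0, c)"
| "sym_code (Prime c) = prod_encode (1, c)"

fun tm_code :: "tm \<Rightarrow> nat" where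
  "tm_code (Var x) = prod_encode (0, x)"
| "tm_code (Fn f ts) =
     prod_encode (1, prod_encode (sym_code f, list_encode (map tm_code ts)))"

fun fm_code :: "fm \<Rightarrow> nat" where
  "fm_code Fls = prod_encode (0, 0)"
| "fm_code (Eq s t) = prod_encode (1, prod_encode (tm_code s, tm_code t))"
| "fm_code (Pre p ts) = prod_encode (2, prod_encode (p, list_encode (map tm_code ts)))"
| "fm_code (Imp \<phi> \<psi>) = prod_encode (3, prod_encode (fm_code \<phi>, fm_code \<psi>))"
| "fm_code (All x \<phi>) = prod_encode (4, prod_encode (x, fm_code \<phi>))"

fun instance_code :: "fm \<times> fm \<times> fm \<Rightarrow> nat" where
  "instance_code (\<iota>, \<upsilon>, \<Phi>) =
     prod_encode (fm_code \<iota>, prod_encode (fm_code \<upsilon>, fm_code \<Phi>))"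

text \<open>
  \<open>decidable_on\<close> and \<open>computable_on\<close> only constrain the algorithm on codes of elements of
  \<open>D\<close>, so \<open>\<Sigma>\<^sub>0\<close> and \<open>Pred\<close> themselves need not be decidable. An instance consists of
  \<open>Init\<close>, \<open>Update\<close> and \<open>\<Phi>\<close>; the theory, the signature and \<open>V\<close> are fixed.
\<close>

definition instances :: "(fm \<Rightarrow> fm \<Rightarrow> system) \<Rightarrow> (fm \<times> fm \<times> fm) set" where
  "instances S =
     {(\<iota>, \<upsilon>, \<Phi>). wf_system (S \<iota> \<upsilon>) \<and> formula (state_sig (S \<iota> \<upsilon>)) \<Phi>}"

end

theory Submission
  imports Defs
begin

text \<open>
  \<open>\<Phi>\<close> is an inductive invariant iff \<open>(Init \<longrightarrow> \<Phi>) \<and> (\<Phi> \<longrightarrow> Update \<longrightarrow> \<Phi>')\<close> is a consequence of the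
  theory. The constants outside \<open>\<Sigma>\<^sub>0\<close> and the primed constants are free, so they may be replaced by
  distinct fresh variables, and the question concerns a \<open>\<Sigma>\<^sub>0\<close>-formula \<open>\<theta>\<close>. Then \<open>qe \<theta>\<close> is
  quantifier-free and reduces (a) to the quantifier-free fragment. For (b), quantify universally over
  all variables of \<open>\<theta>\<close> that do not stand for parameters, eliminate these quantifiers, and put the
  parameters back for the remaining variables. On codes, every substitution is a course-of-values
  recursion.
\<close>

section \<open>Recursive functions\<close>

text \<open>The algorithms cannot ask whether a symbol lies in \<open>F0\<close> or
  \<open>Pr\<close>, as these sets need not be decidable. The translation therefore tests only
  membership in \<open>P\<close>, \<open>N\<close> and \<open>V\<close> and leaves all other symbols
  alone; well-formedness of the instance then places those in \<open>F0\<close>. Quantifying the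
  non-parameters away gives a weakest condition because a constraint on the parameters cannot
  distinguish two models of the theory that differ only in the remaining constants. Semantically
  this needs a passage in both directions: an assignment reinterprets constants
  (\<open>expand\<close>), and a structure is read as an assignment (\<open>env\<close>). An
  obstacle shapes the result of (b). \<open>qe\<close> may return variables foreign to its input, so
  the outcome need not be a sentence. Closing it in every case would spoil quantifier-freeness when
  \<open>qe\<close> behaves well, so the need for closing has to be detected by a computable
  test.\<close>

lemma recursive_in_id: "recursive_in Or (\<lambda>x. x)"
  using recursive_in.pair[OF recursive_in.left recursive_in.right] by simp

lemma recursive_in_const: "recursive_in Or (\<lambda>x. n)"
  by (induction n) (auto intro: recursive_in.zero recursive_in.comp[OF recursive_in.suc])

lemmas recursive_in_fst = recursive_in.comp[OF recursive_in.left]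
lemmas recursive_in_snd = recursive_in.comp[OF recursive_in.right]
lemmas recursive_in_Suc = recursive_in.comp[OF recursive_in.suc]

text \<open>The scheme \<open>prim_rec\<close> is run on \<open>prod_encode (m x, x)\<close>: the
  whole argument serves as parameter, so base, step and bound may all depend on \<open>x\<close>.
  The third premise unpacks the nested pair of counter, value and argument.\<close>

lemma recursive_in_rec_nat:
  assumes "recursive_in Or f" and "recursive_in Or m"
    and "recursive_in Or (\<lambda>z. h (fst (prod_decode z)) (fst (prod_decode (snd (prod_decode z))))
      (snd (prod_decode (snd (prod_decode z)))))"
  shows "recursive_in Or (\<lambda>x. rec_nat (f x) (\<lambda>k r. h k r x) (m x))"
  using recursive_in.comp[OF recursive_in.prim_rec[OF assms(1,3)]
      recursive_in.pair[OF assms(2) recursive_in_id]]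
  by simp

lemma recursive_in_diff:
  assumes "recursive_in Or f" and "recursive_in Or g"
  shows "recursive_in Or (\<lambda>x. f x - g x)"
proof -
  \<comment> \<open>The step of a recursion sees its counter, so returning the counter gives the
    predecessor; iterating it gives truncated subtraction.\<close>
  have pred: "n - 1 = rec_nat 0 (\<lambda>k r. k) n" for n :: nat
    by (cases n) auto
  have "a - b = rec_nat a (\<lambda>k r. r - 1) b" for a b :: nat
    by (induction b) auto
  then have eq: "(\<lambda>x. f x - g x) = (\<lambda>x. rec_nat (f x) (\<lambda>k r. rec_nat 0 (\<lambda>k r. k) r) (g x))"
    unfolding pred by simp
  show ?thesis
    unfolding eq
    by (intro recursive_in_rec_nat assms recursive_in_const recursive_in_fst recursive_in_snd
        recursive_in_id)
qed

lemma recursive_in_if_eq: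
  assumes "recursive_in Or f" and "recursive_in Or g" and "recursive_in Or a" and "recursive_in Or b"
  shows "recursive_in Or (\<lambda>x. if f x = g x then a x else b x)"
proof -
  \<comment> \<open>A recursion whose step ignores the previous value is a zero test. Two numbers
    are equal iff both truncated differences vanish.\<close>
  have eq: "(\<lambda>x. if f x = g x then a x else b x) =
      (\<lambda>x. rec_nat (rec_nat (a x) (\<lambda>k r. b x) (f x - g x)) (\<lambda>k r. b x) (g x - f x))"
  proof
    fix x
    show "(if f x = g x then a x else b x) =
        rec_nat (rec_nat (a x) (\<lambda>k r. b x) (f x - g x)) (\<lambda>k r. b x) (g x - f x)"
      by (cases "f x - g x"; cases "g x - f x") auto
  qed
  show ?thesis
    unfolding eq
    by (intro recursive_in_rec_nat recursive_in_diff assms recursive_in_snd recursive_in_id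
        recursive_in.comp[OF assms(4)])
qed

lemmas recursive_in_intros = recursive_in_id recursive_in_const recursive_in_fst recursive_in_snd
  recursive_in_Suc recursive_in.pair recursive_in_diff recursive_in_if_eq

lemma recursive_in_if:
  assumes "recursive_in Or (\<lambda>x. of_bool (P x))" and "recursive_in Or a" and "recursive_in Or b"
  shows "recursive_in Or (\<lambda>x. if P x then a x else b x)"
proof -
  have "(\<lambda>x. if P x then a x else b x) = (\<lambda>x. if of_bool (P x) = (1 :: nat) then a x else b x)"
    by (rule ext) simp
  moreover have "recursive_in Or \<dots>"
    by (intro recursive_in_intros assms)
  ultimately show ?thesis
    by simp
qed

lemma decidable_set_iff: "decidable_set Or A \<longleftrightarrow> recursive_in Or (\<lambda>x. of_bool (x \<in> A))"
proof -
  have "f = (\<lambda>x. of_bool (x \<in> A))" if "\<forall>x. f x = of_bool (x \<in> A)" for f :: "nat \<Rightarrow> nat"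
    using that by blast
  then show ?thesis
    unfolding decidable_on_def computable_on_def by auto
qed

lemma recursive_in_if_mem:
  assumes "decidable_set Or A" and "recursive_in Or f" and "recursive_in Or a" and "recursive_in Or b"
  shows "recursive_in Or (\<lambda>x. if f x \<in> A then a x else b x)"
  using assms(1) unfolding decidable_set_iff
  by (intro recursive_in_if assms(3,4) recursive_in.comp[OF _ assms(2)])

text \<open>
  Course-of-values recursion becomes primitive recursion on the table of all previous values,
  which stores the latest value first.
\<close>

primrec history :: "(nat \<Rightarrow> nat) \<Rightarrow> nat \<Rightarrow> nat" where
  "history F 0 = 0"
| "history F (Suc n) = prod_encode (F n, history F n)"

text \<open>In \<open>history F n\<close> the entry for \<open>m\<close> lies below the
  \<open>n - Suc m\<close> later entries, so that many tails are taken before the head.\<close>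

definition lookup :: "nat \<Rightarrow> nat \<Rightarrow> nat \<Rightarrow> nat" where
  "lookup n h m = fst (prod_decode (rec_nat h (\<lambda>_ r. snd (prod_decode r)) (n - Suc m)))"

lemma lookup_history:
  assumes "m < n"
  shows "lookup n (history F n) m = F m"
proof -
  \<comment> \<open>Generalized over \<open>k\<close>: the outermost tail is the last one taken, so
    the induction hypothesis is applied at \<open>Suc k\<close>. For \<open>k = Suc m\<close> the
    head is \<open>F m\<close>.\<close>
  have "rec_nat (history F (d + k)) (\<lambda>_ r. snd (prod_decode r)) d = history F k" for d k
    by (induction d arbitrary: k) (simp_all flip: add_Suc_right)
  from this[of "n - Suc m" "Suc m"] assms show ?thesis
    by (simp add: lookup_def)
qed

lemma recursive_in_lookup:
  assumes "recursive_in Or f" and "recursive_in Or g" and "recursive_in Or h"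
  shows "recursive_in Or (\<lambda>x. lookup (f x) (g x) (h x))"
  unfolding lookup_def
  by (intro recursive_in_rec_nat recursive_in_intros assms)

lemma course_of_values:
  assumes "recursive_in Or (\<lambda>z. g (fst (prod_decode z)) (snd (prod_decode z)))"
  obtains F where "recursive_in Or F" and "\<And>n. F n = g n (history F n)"
proof
  let ?tab = "rec_nat 0 (\<lambda>k r. prod_encode (g k r, r))"
  let ?F = "\<lambda>n. g n (?tab n)"
  have g: "recursive_in Or (\<lambda>x. g (a x) (b x))" if "recursive_in Or a" "recursive_in Or b" for a b
    using recursive_in.comp[OF assms recursive_in.pair[OF that]] by simp
  show "recursive_in Or ?F"
    by (intro g recursive_in_rec_nat recursive_in_intros)
  have "history ?F n = ?tab n" for n
    by (induction n) simp_all
  then show "?F n = g n (history ?F n)" for n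
    by simp
qed

section \<open>Substitution on codes\<close>

text \<open>One scheme for all translations used here: priming, turning constants into variables,
  and turning variables back into parameters. The test for an empty argument list spares a symbol of
  the same name with positive arity.\<close>

fun subst_tm :: "(nat \<Rightarrow> tm) \<Rightarrow> (sym \<Rightarrow> tm) \<Rightarrow> tm \<Rightarrow> tm" where
  "subst_tm v k (Var x) = v x"
| "subst_tm v k (Fn f ts) = (if ts = [] then k f else Fn f (map (subst_tm v k) ts))"

text \<open>Capture is not prevented here; each use excludes it separately, by leaving variables
  unchanged, by disjoint kinds of variables, or by a quantifier-free argument.\<close>

fun subst_fm :: "(nat \<Rightarrow> tm) \<Rightarrow> (sym \<Rightarrow> tm) \<Rightarrow> (nat \<Rightarrow> nat) \<Rightarrow> fm \<Rightarrow> fm" where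
  "subst_fm v k q Fls = Fls"
| "subst_fm v k q (Eq s t) = Eq (subst_tm v k s) (subst_tm v k t)"
| "subst_fm v k q (Pre p ts) = Pre p (map (subst_tm v k) ts)"
| "subst_fm v k q (Imp \<phi> \<psi>) = Imp (subst_fm v k q \<phi>) (subst_fm v k q \<psi>)"
| "subst_fm v k q (All x \<phi>) = All (q x) (subst_fm v k q \<phi>)"

text \<open>Course-of-values recursion must descend to smaller codes. As
  \<open>prod_encode (0, 0)\<close> is 0, strictness requires a positive tag.\<close>

lemma less_prod_encode: "0 < a \<Longrightarrow> y < prod_encode (a, y)"
  using le_prod_encode_2[of y "a - 1"] by (cases a) (simp_all add: prod_encode_def)

text \<open>Terms and argument lists are mutually recursive, so a single course-of-values recursion
  computes a pair: its first component treats the number as the code of a term, its second as the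
  code of a list.\<close>

lemma recursive_in_subst_tm:
  assumes "computable_on Or id tm_code UNIV v" and "computable_on Or sym_code tm_code UNIV k"
  obtains T L where "recursive_in Or T"
    and "\<forall>t. T (tm_code t) = tm_code (subst_tm v k t)"
    and "recursive_in Or L"
    and "\<forall>ts. L (list_encode (map tm_code ts)) = list_encode (map tm_code (map (subst_tm v k) ts))"
proof -
  obtain vc kc where vc: "recursive_in Or vc" "\<And>x. vc x = tm_code (v x)"
    and kc: "recursive_in Or kc" "\<And>s. kc (sym_code s) = tm_code (k s)"
    using assms unfolding computable_on_def by auto
  let ?pT = "\<lambda>z. fst (prod_decode z)" and ?pL = "\<lambda>z. snd (prod_decode z)"
  \<comment> \<open>An argument list has code 0 iff it is empty, which is the test for a constant.
    In the list component, \<open>n - 1\<close> removes the \<open>Suc\<close> that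
    \<open>list_encode\<close> puts on a nonempty list.\<close>
  define g where "g n h = prod_encode
     (if fst (prod_decode n) = 0 then vc (snd (prod_decode n))
      else if snd (prod_decode (snd (prod_decode n))) = 0
        then kc (fst (prod_decode (snd (prod_decode n))))
      else prod_encode (1, prod_encode (fst (prod_decode (snd (prod_decode n))),
        ?pL (lookup n h (snd (prod_decode (snd (prod_decode n))))))),
      if n = 0 then 0
      else Suc (prod_encode (?pT (lookup n h (fst (prod_decode (n - 1)))),
        ?pL (lookup n h (snd (prod_decode (n - 1)))))))" for n h
  have "recursive_in Or (\<lambda>z. g (fst (prod_decode z)) (snd (prod_decode z)))"
    unfolding g_def
    by (intro recursive_in_intros recursive_in_lookup recursive_in.comp[OF vc(1)]
        recursive_in.comp[OF kc(1)])
  then obtain F where F: "recursive_in Or F" "\<And>n. F n = g n (history F n)"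
    by (rule course_of_values) blast
  have L_Nil: "?pL (F 0) = 0"
    unfolding F(2)[of 0] by (simp add: g_def)
  have L_Cons: "?pL (F (Suc (prod_encode (a, b)))) = Suc (prod_encode (?pT (F a), ?pL (F b)))" for a b
    unfolding F(2)[of "Suc _"]
    by (simp add: g_def lookup_history le_imp_less_Suc le_prod_encode_1 le_prod_encode_2
        del: history.simps)
  have T_Var: "?pT (F (prod_encode (0, x))) = vc x" for x
    unfolding F(2)[of "prod_encode _"] by (simp add: g_def)
  have T_const: "?pT (F (prod_encode (1, prod_encode (s, 0)))) = kc s" for s
    unfolding F(2)[of "prod_encode _"] by (simp add: g_def)
  have T_Fn: "?pT (F (prod_encode (1, prod_encode (s, l)))) = prod_encode (1, prod_encode (s, ?pL (F l)))"
    if "l \<noteq> 0" for s l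
  proof -
    have "l < prod_encode (1, prod_encode (s, l))"
      using le_prod_encode_2[of l s] less_prod_encode[of 1 "prod_encode (s, l)"] by simp
    then show ?thesis
      unfolding F(2)[of "prod_encode _"] using that by (simp add: g_def lookup_history)
  qed
  \<comment> \<open>The claim is assumed only for the members of the list, which makes this usable
    inside the induction on terms.\<close>
  have list: "?pL (F (list_encode (map tm_code ts))) = list_encode (map tm_code (map (subst_tm v k) ts))"
    if "\<And>t. t \<in> set ts \<Longrightarrow> ?pT (F (tm_code t)) = tm_code (subst_tm v k t)" for ts
    using that by (induction ts) (simp_all add: L_Nil L_Cons)
  have tm: "?pT (F (tm_code t)) = tm_code (subst_tm v k t)" for t
  proof (induction t)
    case (Var x)
    then show ?case by (simp add: T_Var vc(2))
  next
    case (Fn f ts)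
    show ?case
    proof (cases ts)
      case Nil
      then show ?thesis by (simp add: T_const[simplified] kc(2))
    next
      case (Cons t us)
      then have "list_encode (map tm_code ts) \<noteq> 0" by simp
      from T_Fn[OF this] list[of ts, OF Fn.IH] Cons show ?thesis by simp
    qed
  qed
  show ?thesis
    using that[OF recursive_in_fst[OF F(1)] _ recursive_in_snd[OF F(1)]] tm list[OF tm] by simp
qed

text \<open>Formulas have no lists of formulas as parts, so one component suffices; terms and
  argument lists are handed to the functions already obtained for them.\<close>

lemma computable_on_subst_fm:
  assumes "computable_on Or id tm_code UNIV v" and "computable_on Or sym_code tm_code UNIV k"
    and q: "recursive_in Or q" and "computable_on Or c fm_code D H"
  shows "computable_on Or c fm_code D (\<lambda>x. subst_fm v k q (H x))"
proof -
  obtain T L where T: "recursive_in Or T" "\<forall>t. T (tm_code t) = tm_code (subst_tm v k t)"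
    and L: "recursive_in Or L"
      "\<forall>ts. L (list_encode (map tm_code ts)) = list_encode (map tm_code (map (subst_tm v k) ts))"
    by (rule recursive_in_subst_tm[OF assms(1,2)]) (rule that; assumption)
  define g where "g n h =
    (let a = fst (prod_decode n); b = fst (prod_decode (snd (prod_decode n)));
       d = snd (prod_decode (snd (prod_decode n)))
     in if a = 0 then n
        else if a = 1 then prod_encode (1, prod_encode (T b, T d))
        else if a = 2 then prod_encode (2, prod_encode (b, L d))
        else if a = 3 then prod_encode (3, prod_encode (lookup n h b, lookup n h d))
        else prod_encode (4, prod_encode (q b, lookup n h d)))" for n h
  have "recursive_in Or (\<lambda>z. g (fst (prod_decode z)) (snd (prod_decode z)))"
    unfolding g_def Let_def
    by (intro recursive_in_intros recursive_in_lookup recursive_in.comp[OF T(1)]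
        recursive_in.comp[OF L(1)] recursive_in.comp[OF q])
  then obtain F where F: "recursive_in Or F" "\<And>n. F n = g n (history F n)"
    by (rule course_of_values) blast
  have less: "b < prod_encode (a, prod_encode (b, d))" "d < prod_encode (a, prod_encode (b, d))"
    if "0 < a" for a b d
    using that by (blast intro: le_less_trans le_prod_encode_1 le_prod_encode_2 less_prod_encode)+
  have "F (fm_code \<phi>) = fm_code (subst_fm v k q \<phi>)" for \<phi>
  proof (induction \<phi>)
    case Fls
    show ?case unfolding F(2)[of "fm_code _"] by (simp add: g_def)
  next
    case (Eq s t)
    show ?case unfolding F(2)[of "fm_code _"] by (simp add: g_def T(2))
  next
    case (Pre p ts)
    show ?case unfolding F(2)[of "fm_code _"] using L(2)[rule_format, of ts] by (simp add: g_def)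
  next
    case (Imp \<phi> \<psi>)
    then show ?case unfolding F(2)[of "fm_code (Imp _ _)"] by (simp add: g_def lookup_history less)
  next
    case (All x \<phi>)
    then show ?case unfolding F(2)[of "fm_code (All _ _)"] by (simp add: g_def lookup_history less)
  qed
  moreover obtain f where "recursive_in Or f" "\<And>x. x \<in> D \<Longrightarrow> f (c x) = fm_code (H x)"
    using assms(4) unfolding computable_on_def by blast
  ultimately show ?thesis
    unfolding computable_on_def by (intro exI[of _ "\<lambda>x. F (f x)"]) (simp add: recursive_in.comp F(1))
qed

section \<open>Combinators for computable maps into formulas\<close>

lemma computable_on_cong:
  assumes "\<And>x. x \<in> D \<Longrightarrow> F x = G x" and "computable_on Or c d D F"
  shows "computable_on Or c d D G"
  using assms unfolding computable_on_def by simp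

lemma computable_on_Imp:
  assumes "computable_on Or c fm_code D F" and "computable_on Or c fm_code D G"
  shows "computable_on Or c fm_code D (\<lambda>x. Imp (F x) (G x))"
proof -
  obtain f g where f: "recursive_in Or f" "\<forall>x\<in>D. f (c x) = fm_code (F x)"
    and g: "recursive_in Or g" "\<forall>x\<in>D. g (c x) = fm_code (G x)"
    using assms unfolding computable_on_def by auto
  show ?thesis
    unfolding computable_on_def
    by (rule exI[of _ "\<lambda>n. prod_encode (3, prod_encode (f n, g n))"])
      (use f(2) g(2) in \<open>simp add: recursive_in.pair recursive_in_const f(1) g(1)\<close>)
qed

lemma computable_on_Fls: "computable_on Or c fm_code D (\<lambda>x. Fls)"
  unfolding computable_on_def
  by (rule exI[of _ "\<lambda>n. fm_code Fls"]) (simp add: recursive_in_const del: fm_code.simps)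

lemma computable_on_comp:
  assumes "computable_on Or c d D F" and "computable_on Or d e E G" and "F ` D \<subseteq> E"
  shows "computable_on Or c e D (\<lambda>x. G (F x))"
proof -
  obtain f g where f: "recursive_in Or f" "\<forall>x\<in>D. f (c x) = d (F x)"
    and g: "recursive_in Or g" "\<forall>x\<in>E. g (d x) = e (G x)"
    using assms unfolding computable_on_def by auto
  show ?thesis
    unfolding computable_on_def
    by (rule exI[of _ "\<lambda>n. g (f n)"]) (use f g assms(3) in \<open>auto intro: recursive_in.comp\<close>)
qed

lemma computable_on_if_code_eq:
  assumes "computable_on Or c fm_code D F" and "computable_on Or c fm_code D G"
    and "computable_on Or c fm_code D H" and "computable_on Or c fm_code D K"
  shows "computable_on Or c fm_code D
    (\<lambda>x. if fm_code (F x) = fm_code (G x) then H x else K x)"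
proof -
  obtain f g h k where f: "recursive_in Or f" "\<forall>x\<in>D. f (c x) = fm_code (F x)"
    and g: "recursive_in Or g" "\<forall>x\<in>D. g (c x) = fm_code (G x)"
    and h: "recursive_in Or h" "\<forall>x\<in>D. h (c x) = fm_code (H x)"
    and k: "recursive_in Or k" "\<forall>x\<in>D. k (c x) = fm_code (K x)"
    using assms unfolding computable_on_def by auto
  show ?thesis
    unfolding computable_on_def
    by (rule exI[of _ "\<lambda>n. if f n = g n then h n else k n"])
      (use f(2) g(2) h(2) k(2) in \<open>simp add: recursive_in_if_eq f(1) g(1) h(1) k(1)\<close>)
qed

primrec close :: "(nat \<Rightarrow> bool) \<Rightarrow> nat \<Rightarrow> fm \<Rightarrow> fm" where
  "close P 0 \<phi> = \<phi>"
| "close P (Suc n) \<phi> = (if P n then close P n \<phi> else All n (close P n \<phi>))"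

text \<open>
  The code of a formula bounds the indices of its free variables, so that they need not be
  computed; a vacuous quantifier does no harm since universes are nonempty.
\<close>

abbreviation close_all :: "(nat \<Rightarrow> bool) \<Rightarrow> fm \<Rightarrow> fm" where
  "close_all P \<phi> \<equiv> close P (Suc (fm_code \<phi>)) \<phi>"

lemma computable_on_close_all:
  assumes "recursive_in Or (\<lambda>x. of_bool (P x))" and "computable_on Or c fm_code D F"
  shows "computable_on Or c fm_code D (\<lambda>x. close_all P (F x))"
proof -
  obtain f where f: "recursive_in Or f" "\<forall>x\<in>D. f (c x) = fm_code (F x)"
    using assms unfolding computable_on_def by auto
  \<comment> \<open>This is the step of \<open>close\<close> on codes, 4 being the tag of
    \<open>All\<close>.\<close>
  let ?h = "\<lambda>k r. if P k then r else prod_encode (4, prod_encode (k, r))"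
  have "fm_code (close P n \<phi>) = rec_nat (fm_code \<phi>) ?h n" for n \<phi>
    by (induction n) simp_all
  moreover have "recursive_in Or (\<lambda>n. rec_nat (f n) ?h (Suc (f n)))"
    by (intro recursive_in_rec_nat recursive_in_if recursive_in_intros f(1)
        recursive_in.comp[OF assms(1)])
  ultimately show ?thesis
    using f(2) unfolding computable_on_def by (intro exI[of _ "\<lambda>n. rec_nat (f n) ?h (Suc (f n))"]) simp
qed

section \<open>Exchanging constants and variables\<close>

definition prime_const :: "nat set \<Rightarrow> sym \<Rightarrow> tm" where
  "prime_const V f = Fn (prime_sym (constants V) f 0) []"

text \<open>Only variables of the system change, no function symbols, so priming touches nullary
  symbols only and is an instance of the general substitution.\<close>

lemma prime_fm_constants: "prime_fm (constants V) \<phi> = subst_fm Var (prime_const V) id \<phi>"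
proof -
  have sym: "prime_sym (constants V) f (Suc n) = f" for f n
    by (cases f) (auto simp: constants_def)
  have tm: "prime_tm (constants V) t = subst_tm Var (prime_const V) t" for t
  proof (induction t)
    case (Fn f ts)
    then show ?case by (cases ts) (auto simp: prime_const_def sym)
  qed simp
  show ?thesis
    by (induction \<phi>) (auto simp: tm)
qed

text \<open>
  Logical variables, primed constants, non-parametric constants and parameters become variables
  of the kinds 0, 1, 2 and 3, so that no two of them are identified.
\<close>

fun const_to_var :: "nat set \<Rightarrow> nat set \<Rightarrow> sym \<Rightarrow> tm" where
  "const_to_var P N (Sym c) =
    (if c \<in> N then Var (prod_encode (2, c)) else if c \<in> P then Var (prod_encode (3, c))
     else Fn (Sym c) [])"
| "const_to_var P N (Prime c) = Var (prod_encode (1, c))"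

abbreviation consts_to_vars :: "nat set \<Rightarrow> nat set \<Rightarrow> fm \<Rightarrow> fm" where
  "consts_to_vars P N \<equiv>
    subst_fm (\<lambda>x. Var (prod_encode (0, x))) (const_to_var P N) (\<lambda>x. prod_encode (0, x))"

definition param :: "nat set \<Rightarrow> nat \<Rightarrow> bool" where
  "param P v \<longleftrightarrow> fst (prod_decode v) = 3 \<and> snd (prod_decode v) \<in> P"

text \<open>The map \<open>u\<close> on the other variables is left open because the substitution is
  carried out twice, with \<open>id\<close> and with \<open>Suc\<close>; comparing the results
  reveals whether a non-parameter variable occurs.\<close>

definition var_to_param :: "nat set \<Rightarrow> (nat \<Rightarrow> nat) \<Rightarrow> nat \<Rightarrow> tm" where
  "var_to_param P u v = (if param P v then Fn (Sym (snd (prod_decode v))) [] else Var (u v))"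

abbreviation vars_to_params :: "nat set \<Rightarrow> (nat \<Rightarrow> nat) \<Rightarrow> fm \<Rightarrow> fm" where
  "vars_to_params P u \<equiv> subst_fm (var_to_param P u) (\<lambda>f. Fn f []) id"

lemma computable_on_sym:
  assumes "recursive_in Or f" and "recursive_in Or g"
    and "\<And>c. f c = tm_code (k (Sym c))" and "\<And>c. g c = tm_code (k (Prime c))"
  shows "computable_on Or sym_code tm_code UNIV k"
proof -
  have "recursive_in Or (\<lambda>n. if fst (prod_decode n) = 0 then f (snd (prod_decode n)) else g (snd (prod_decode n)))"
    by (intro recursive_in_intros recursive_in.comp[OF assms(1)] recursive_in.comp[OF assms(2)])
  moreover have "(if fst (prod_decode (sym_code s)) = 0 then f (snd (prod_decode (sym_code s)))
      else g (snd (prod_decode (sym_code s)))) = tm_code (k s)" for s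
    by (cases s) (simp_all add: assms)
  ultimately show ?thesis
    unfolding computable_on_def by blast
qed

lemma computable_on_prime_fm:
  assumes "decidable_set Or V" and "computable_on Or c fm_code D F"
  shows "computable_on Or c fm_code D (\<lambda>x. prime_fm (constants V) (F x))"
proof -
  let ?c = "\<lambda>a c. prod_encode (1, prod_encode (prod_encode (a, c), 0))"
  have var: "computable_on Or id tm_code UNIV Var"
    unfolding computable_on_def
    by (rule exI[of _ "\<lambda>x. prod_encode (0, x)"]) (simp add: recursive_in.pair recursive_in_const recursive_in_id)
  have "recursive_in Or (\<lambda>c. if c \<in> V then ?c 1 c else ?c 0 c)"
    by (intro recursive_in_if_mem[OF assms(1)] recursive_in_intros)
  moreover have "recursive_in Or (?c 1)"
    by (intro recursive_in_intros)
  ultimately have "computable_on Or sym_code tm_code UNIV (prime_const V)"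
    by (rule computable_on_sym) (simp_all add: prime_const_def constants_def)
  then show ?thesis
    unfolding prime_fm_constants id_def
    using var recursive_in_id assms(2) by (intro computable_on_subst_fm)
qed

lemma computable_on_consts_to_vars:
  assumes "decidable_set Or P" and "decidable_set Or N" and "computable_on Or c fm_code D F"
  shows "computable_on Or c fm_code D (\<lambda>x. consts_to_vars P N (F x))"
proof -
  let ?v = "\<lambda>a c. prod_encode (0, prod_encode (a, c))"
  have var: "computable_on Or id tm_code UNIV (\<lambda>x. Var (prod_encode (0, x)))"
    unfolding computable_on_def
    by (rule exI[of _ "?v 0"]) (simp add: recursive_in.pair recursive_in_const recursive_in_id)
  have "recursive_in Or (\<lambda>c. if c \<in> N then ?v 2 c else if c \<in> P then ?v 3 c
      else prod_encode (1, prod_encode (prod_encode (0, c), 0)))"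
    by (intro recursive_in_if_mem[OF assms(1)] recursive_in_if_mem[OF assms(2)] recursive_in_intros)
  moreover have "recursive_in Or (?v 1)"
    by (intro recursive_in_intros)
  ultimately have "computable_on Or sym_code tm_code UNIV (const_to_var P N)"
    by (rule computable_on_sym) simp_all
  with var show ?thesis
    by (intro computable_on_subst_fm assms(3) recursive_in_intros)
qed

lemma recursive_in_param:
  assumes "decidable_set Or P"
  shows "recursive_in Or (\<lambda>x. of_bool (param P x))"
proof -
  have "(\<lambda>x. of_bool (param P x)) = (\<lambda>x. if fst (prod_decode x) = 3
      then if snd (prod_decode x) \<in> P then 1 else 0 else 0 :: nat)"
    by (auto simp: param_def)
  moreover have "recursive_in Or \<dots>"
    by (intro recursive_in_if_mem[OF assms] recursive_in_intros)
  ultimately show ?thesis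
    by simp
qed

lemma computable_on_vars_to_params:
  assumes "decidable_set Or P" and "recursive_in Or u" and "computable_on Or c fm_code D F"
  shows "computable_on Or c fm_code D (\<lambda>x. vars_to_params P u (F x))"
proof -
  let ?c = "\<lambda>a c. prod_encode (1, prod_encode (prod_encode (a, c), 0))"
  have "recursive_in Or (\<lambda>x. if param P x then ?c 0 (snd (prod_decode x)) else prod_encode (0, u x))"
    by (intro recursive_in_if[OF recursive_in_param[OF assms(1)]] recursive_in_intros assms(2))
  then have "computable_on Or id tm_code UNIV (var_to_param P u)"
    unfolding computable_on_def
    by (intro exI[of _ "\<lambda>x. if param P x then ?c 0 (snd (prod_decode x)) else prod_encode (0, u x)"])
      (simp add: var_to_param_def)
  moreover have c: "recursive_in Or (?c a)" for a
    by (intro recursive_in_intros)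
  have "computable_on Or sym_code tm_code UNIV (\<lambda>f. Fn f [])"
    by (rule computable_on_sym[OF c[of 0] c[of 1]]) simp_all
  ultimately show ?thesis
    using recursive_in_id by (intro computable_on_subst_fm assms(3)) (simp_all add: id_def)
qed

section \<open>Codes\<close>

lemma sym_code_inject: "sym_code f = sym_code g \<Longrightarrow> f = g"
  by (cases f; cases g) simp_all

lemma tm_code_inject: "tm_code s = tm_code t \<Longrightarrow> s = t"
proof (induction s arbitrary: t)
  case (Var x)
  then show ?case by (cases t) simp_all
next
  case (Fn f ts)
  then obtain us where "t = Fn f us" "map tm_code ts = map tm_code us"
    by (cases t) (auto simp: list_encode_eq dest: sym_code_inject)
  moreover from this(2) have "ts = us"
    by (rule list.inj_map_strong[rotated]) (use Fn.IH in blast)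
  ultimately show ?case by simp
qed

text \<open>Lets the comparison of codes in \<open>condition\<close> be read as equality of
  formulas.\<close>

lemma fm_code_inject: "fm_code \<phi> = fm_code \<psi> \<Longrightarrow> \<phi> = \<psi>"
proof (induction \<phi> arbitrary: \<psi>)
  case (Pre p ts)
  then obtain us where "\<psi> = Pre p us" "map tm_code ts = map tm_code us"
    by (cases \<psi>) (auto simp: list_encode_eq)
  moreover from this(2) have "ts = us"
    by (rule list.inj_map_strong[rotated]) (rule tm_code_inject)
  ultimately show ?case by simp
next
  case (Eq s t)
  then show ?case by (cases \<psi>) (auto dest: tm_code_inject)
next
  case Fls
  then show ?case by (cases \<psi>) auto
next
  case (Imp \<phi> \<phi>')
  then show ?case by (cases \<psi>) auto
next
  case (All x \<phi>)
  then show ?case by (cases \<psi>) auto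
qed

lemma member_le_list_encode: "n \<in> set ns \<Longrightarrow> n \<le> list_encode ns"
proof (induction ns)
  case (Cons m ns)
  then show ?case
    using le_prod_encode_1[of m "list_encode ns"] le_prod_encode_2[of "list_encode ns" m]
    by fastforce
qed simp

lemmas le_prod_encode =
  order_trans[OF _ le_prod_encode_1] order_trans[OF _ le_prod_encode_2]

lemma fv_tm_le_code: "x \<in> fv_tm t \<Longrightarrow> x \<le> tm_code t"
proof (induction t)
  case (Var y)
  then show ?case using le_prod_encode_2 by simp
next
  case (Fn f ts)
  then obtain t where t: "t \<in> set ts" "x \<le> tm_code t"
    by auto
  have "tm_code t \<le> list_encode (map tm_code ts)"
    using t(1) by (intro member_le_list_encode) simp
  with t(2) show ?case
    by (auto intro!: le_prod_encode(2))
qed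

lemma fv_le_code: "x \<in> fv \<phi> \<Longrightarrow> x \<le> fm_code \<phi>"
proof (induction \<phi>)
  case (Eq s t)
  then have "x \<le> tm_code s \<or> x \<le> tm_code t"
    by (auto dest: fv_tm_le_code)
  then show ?case
    by (auto intro: le_prod_encode)
next
  case (Pre p ts)
  then obtain t where t: "t \<in> set ts" "x \<le> tm_code t"
    by (auto dest: fv_tm_le_code)
  have "tm_code t \<le> list_encode (map tm_code ts)"
    using t(1) by (intro member_le_list_encode) simp
  with t(2) show ?case
    by (auto intro!: le_prod_encode(2))
next
  case (Imp \<phi> \<psi>)
  then have "x \<le> fm_code \<phi> \<or> x \<le> fm_code \<psi>"
    by auto
  then show ?case
    by (auto intro: le_prod_encode)
next
  case (All y \<phi>)
  then have "x \<le> fm_code \<phi>"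
    by simp
  then show ?case
    by (auto intro!: le_prod_encode(2))
qed simp

section \<open>Semantics of the transformations\<close>

lemma val_cong:
  assumes "wf_tm F t"
    and "\<And>f xs. (f, length xs) \<in> F \<Longrightarrow> func M f xs = func M' f xs"
    and "\<And>x. x \<in> fv_tm t \<Longrightarrow> e x = e' x"
  shows "val M e t = val M' e' t"
  using assms(1,3)
proof (induction t)
  case (Fn f ts)
  then have "map (val M e) ts = map (val M' e') ts"
    by auto
  moreover have "func M f (map (val M' e') ts) = func M' f (map (val M' e') ts)"
    by (rule assms(2)) (use Fn.prems in simp)
  ultimately show ?case by (simp only: val.simps)
qed simp

lemma sat_cong:
  assumes "formula \<Pi> \<phi>" and "univ M = univ M'" and "pred M = pred M'"
    and func: "\<And>f xs. (f, length xs) \<in> fst \<Pi> \<Longrightarrow> func M f xs = func M' f xs"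
    and "\<And>x. x \<in> fv \<phi> \<Longrightarrow> e x = e' x"
  shows "sat M e \<phi> \<longleftrightarrow> sat M' e' \<phi>"
  using assms(1,5)
proof (induction \<phi> arbitrary: e e')
  case (Eq s t)
  then show ?case
    using val_cong[OF _ func, of "fst \<Pi>" s e e'] val_cong[OF _ func, of "fst \<Pi>" t e e'] by simp
next
  case (Pre p ts)
  then have "val M e t = val M' e' t" if "t \<in> set ts" for t
    using that by (intro val_cong[of "fst \<Pi>"] func) auto
  then show ?case
    using assms(3) by (simp cong: map_cong)
next
  case (Imp \<phi> \<psi>)
  then show ?case by (metis UnCI fv.simps(4) formula.simps(4) sat.simps(4))
next
  case (All x \<phi>)
  have "sat M (e(x := a)) \<phi> \<longleftrightarrow> sat M' (e'(x := a)) \<phi>" for a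
    using All.prems by (intro All.IH) auto
  then show ?case
    using assms(2) by simp
qed simp

lemma sat_sentence:
  assumes "sentence \<Pi> \<phi>"
  shows "sat M e \<phi> \<longleftrightarrow> sat M e' \<phi>"
  using assms by (intro sat_cong[of \<Pi>]) (auto simp: sentence_def)

text \<open>A block of quantifiers acts as one quantifier over whole assignments, which avoids
  tuples of values. Indices from \<open>n\<close> on are not yet bound, hence the agreement required
  there.\<close>

lemma sat_close:
  assumes "range e \<subseteq> univ M"
  shows "sat M e (close P n \<phi>) \<longleftrightarrow>
    (\<forall>e'. range e' \<subseteq> univ M \<and> (\<forall>i. P i \<or> n \<le> i \<longrightarrow> e' i = e i) \<longrightarrow> sat M e' \<phi>)"
  using assms
proof (induction n arbitrary: e)
  case 0
  show ?case
  proof (intro iffI allI impI)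
    fix e' assume "sat M e (close P 0 \<phi>)"
      and "range e' \<subseteq> univ M \<and> (\<forall>i. P i \<or> 0 \<le> i \<longrightarrow> e' i = e i)"
    moreover from this(2) have "e' = e" by auto
    ultimately show "sat M e' \<phi>" by simp
  qed (use 0 in auto)
next
  case (Suc n)
  show ?case
  proof (cases "P n")
    case True
    then have "(P i \<or> Suc n \<le> i) \<longleftrightarrow> (P i \<or> n \<le> i)" for i
      by (metis Suc_leD le_antisym not_less_eq_eq)
    with True show ?thesis
      using Suc by simp
  next
    case False
    define agree where "agree e' a \<longleftrightarrow> (\<forall>i. P i \<or> n \<le> i \<longrightarrow> e' i = (e(n := a)) i)" for e' a
    have "sat M (e(n := a)) (close P n \<phi>) \<longleftrightarrow> (\<forall>e'. range e' \<subseteq> univ M \<and> agree e' a \<longrightarrow> sat M e' \<phi>)"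
      if "a \<in> univ M" for a
      unfolding agree_def using Suc.prems that by (intro Suc.IH) auto
    then have "sat M e (close P (Suc n) \<phi>) \<longleftrightarrow>
        (\<forall>a\<in>univ M. \<forall>e'. range e' \<subseteq> univ M \<and> agree e' a \<longrightarrow> sat M e' \<phi>)"
      using False by simp
    also have "\<dots> \<longleftrightarrow> (\<forall>e'. range e' \<subseteq> univ M \<and> (\<exists>a\<in>univ M. agree e' a) \<longrightarrow> sat M e' \<phi>)"
      by blast
    also have "\<dots> \<longleftrightarrow>
        (\<forall>e'. range e' \<subseteq> univ M \<and> (\<forall>i. P i \<or> Suc n \<le> i \<longrightarrow> e' i = e i) \<longrightarrow> sat M e' \<phi>)"
    proof (intro iff_allI imp_cong conj_cong refl)
      fix e' :: "nat \<Rightarrow> 'a"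
      assume e': "range e' \<subseteq> univ M"
      \<comment> \<open>The value chosen by the outermost quantifier is recovered from the
        assignment as \<open>e' n\<close>.\<close>
      have "agree e' (e' n)" if "\<forall>i. P i \<or> Suc n \<le> i \<longrightarrow> e' i = e i"
        using that by (auto simp: agree_def Suc_le_eq)
      moreover have "e' i = e i" if "agree e' a" "P i \<or> Suc n \<le> i" for a i
        using that False by (metis Suc_leD agree_def fun_upd_other not_less_eq_eq order_refl)
      ultimately show "(\<exists>a\<in>univ M. agree e' a) \<longleftrightarrow> (\<forall>i. P i \<or> Suc n \<le> i \<longrightarrow> e' i = e i)"
        using e' by blast
    qed
    finally show ?thesis .
  qed
qed

lemma sat_close_all:
  assumes "formula \<Pi> \<phi>" and "range e \<subseteq> univ M"
  shows "sat M e (close_all P \<phi>) \<longleftrightarrow>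
    (\<forall>e'. range e' \<subseteq> univ M \<and> (\<forall>i. P i \<longrightarrow> e' i = e i) \<longrightarrow> sat M e' \<phi>)"
proof -
  have "sat M e' \<phi>" if closed: "sat M e (close_all P \<phi>)" and e': "range e' \<subseteq> univ M" "\<forall>i. P i \<longrightarrow> e' i = e i"
    for e'
  proof -
    \<comment> \<open>\<open>sat_close\<close> also demands agreement with \<open>e\<close> beyond
      the bound. Cutting \<open>e'\<close> off there is harmless, since no free variable exceeds the
      code.\<close>
    let ?e = "\<lambda>i. if i < Suc (fm_code \<phi>) then e' i else e i"
    have "sat M ?e \<phi>"
    proof (rule closed[unfolded sat_close[OF assms(2)], rule_format], intro conjI allI impI)
      show "range ?e \<subseteq> univ M"
        using e'(1) assms(2) by auto
    qed (use e'(2) in auto)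
    moreover have "sat M ?e \<phi> \<longleftrightarrow> sat M e' \<phi>"
      by (rule sat_cong[OF assms(1)]) (auto dest: fv_le_code)
    ultimately show ?thesis by simp
  qed
  moreover have "sat M e (close_all P \<phi>)"
    if "\<forall>e'. range e' \<subseteq> univ M \<and> (\<forall>i. P i \<longrightarrow> e' i = e i) \<longrightarrow> sat M e' \<phi>"
    unfolding sat_close[OF assms(2)] using that by simp
  ultimately show ?thesis
    by (intro iffI allI impI) (elim conjE; assumption | blast)+
qed

lemma formula_close: "formula \<Pi> (close P n \<phi>) \<longleftrightarrow> formula \<Pi> \<phi>"
  by (induction n) auto

lemma fv_close: "fv (close P n \<phi>) = {i \<in> fv \<phi>. P i \<or> n \<le> i}"
proof (induction n)
  case (Suc n)
  have "n \<le> i \<longleftrightarrow> i = n \<or> Suc n \<le> i" for i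
    by auto
  with Suc show ?case
    by auto
qed simp

lemma fv_close_all: "fv (close_all P \<phi>) = {i \<in> fv \<phi>. P i}"
  unfolding fv_close by (auto dest: fv_le_code)

text \<open>The substitution does not track binders, so below a quantifier it would also replace
  occurrences of the bound variable; quantifier-freeness rules this out.\<close>

lemma sat_vars_to_params:
  assumes "qfree \<chi>"
  shows "sat M e (vars_to_params P u \<chi>) \<longleftrightarrow>
    sat M (\<lambda>v. if param P v then func M (Sym (snd (prod_decode v))) [] else e (u v)) \<chi>"
proof -
  have "val M e (subst_tm (var_to_param P u) (\<lambda>f. Fn f []) t) =
    val M (\<lambda>v. if param P v then func M (Sym (snd (prod_decode v))) [] else e (u v)) t" for t
    by (induction t) (auto simp: var_to_param_def comp_def cong: map_cong)
  with assms show ?thesis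
    by (induction \<chi>) (auto simp: var_to_param_def comp_def cong: map_cong)
qed

lemma qfree_vars_to_params: "qfree \<chi> \<Longrightarrow> qfree (vars_to_params P u \<chi>)"
  by (induction \<chi>) auto

lemma formula_vars_to_params:
  assumes "formula (unprimed F, Pr) \<chi>"
  shows "formula (unprimed (F \<union> constants P), Pr) (vars_to_params P u \<chi>)"
proof -
  have "wf_tm (unprimed (F \<union> constants P)) (subst_tm (var_to_param P u) (\<lambda>f. Fn f []) t)"
    if "wf_tm (unprimed F) t" for t
    using that by (induction t) (auto simp: var_to_param_def param_def unprimed_def constants_def)
  with assms show ?thesis
    by (induction \<chi>) auto
qed

text \<open>Whatever stays free once the parameters are back is therefore bound by
  \<open>close_all (param P)\<close>, which makes the second branch of \<open>condition\<close> a
  sentence.\<close>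

lemma fv_vars_to_params_subset:
  assumes "qfree \<chi>"
  shows "fv (vars_to_params P id \<chi>) \<subseteq> {x. \<not> param P x}"
proof -
  have "\<not> param P x" if "x \<in> fv_tm (subst_tm (var_to_param P id) (\<lambda>f. Fn f []) t)" for x t
    using that by (induction t) (auto simp: var_to_param_def split: if_splits)
  with assms show ?thesis
    by (induction \<chi>) auto
qed

text \<open>\<open>id\<close> and \<open>Suc\<close> agree nowhere, so a single non-parameter
  variable already separates the two images. This gives a test for free variables that needs no
  computation of \<open>fv\<close>.\<close>

lemma vars_to_params_eq_iff:
  assumes "qfree \<chi>"
  shows "vars_to_params P id \<chi> = vars_to_params P Suc \<chi> \<longleftrightarrow> fv \<chi> \<subseteq> Collect (param P)"
proof -
  have tm: "subst_tm (var_to_param P id) (\<lambda>f. Fn f []) t =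
      subst_tm (var_to_param P Suc) (\<lambda>f. Fn f []) t
    \<longleftrightarrow> fv_tm t \<subseteq> Collect (param P)" for t
    by (induction t) (auto simp: var_to_param_def)
  from assms show ?thesis
    by (induction \<chi>) (auto simp: tm)
qed

lemma fv_vars_to_params:
  assumes "qfree \<chi>" and "fv \<chi> \<subseteq> Collect (param P)"
  shows "fv (vars_to_params P u \<chi>) = {}"
proof -
  have "fv_tm (subst_tm (var_to_param P u) (\<lambda>f. Fn f []) t) = {}"
    if "fv_tm t \<subseteq> Collect (param P)" for t
    using that by (induction t) (auto simp: var_to_param_def)
  with assms show ?thesis
    by (induction \<chi>) (simp_all add: UN_subset_iff)
qed

section \<open>Assignments as interpretations of constants\<close>

definition expand :: "nat set \<Rightarrow> nat set \<Rightarrow> 'a struct \<Rightarrow> (nat \<Rightarrow> 'a) \<Rightarrow> 'a struct" where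
  "expand P N M e = M\<lparr>func := \<lambda>f xs. if xs = [] then val M e (const_to_var P N f) else func M f xs\<rparr>"

lemma expand_simps [simp]:
  "univ (expand P N M e) = univ M"
  "pred (expand P N M e) = pred M"
  "func (expand P N M e) f xs = (if xs = [] then val M e (const_to_var P N f) else func M f xs)"
  by (simp_all add: expand_def)

lemma val_consts_to_vars:
  "val M e (subst_tm (\<lambda>x. Var (prod_encode (0, x))) (const_to_var P N) t) =
    val (expand P N M e) (\<lambda>x. e (prod_encode (0, x))) t"
  by (induction t) (auto simp: comp_def cong: map_cong)

text \<open>The substitution lemma for this translation: replacing constants by variables amounts to
  letting the assignment interpret them, while logical variables live at kind 0.\<close>

lemma sat_consts_to_vars:
  "sat M e (consts_to_vars P N \<phi>) \<longleftrightarrow> sat (expand P N M e) (\<lambda>x. e (prod_encode (0, x))) \<phi>"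
proof (induction \<phi> arbitrary: e)
  case (Eq s t)
  show ?case by (simp add: val_consts_to_vars)
next
  case (Pre p ts)
  show ?case by (simp add: val_consts_to_vars comp_def)
next
  case (All x \<phi>)
  \<comment> \<open>Constants only become variables of kinds 1, 2 and 3, so changing a variable of
    kind 0 under a quantifier does not disturb the expansion.\<close>
  have "val M (e(prod_encode (0, x) := a)) (const_to_var P N f) = val M e (const_to_var P N f)" for a f
    by (cases f) auto
  then have "expand P N M (e(prod_encode (0, x) := a)) = expand P N M e" for a
    by (simp add: expand_def cong: if_cong)
  moreover have "(\<lambda>y. (e(prod_encode (0, x) := a)) (prod_encode (0, y))) =
      (\<lambda>y. e (prod_encode (0, y)))(x := a)" for a
    by (auto simp: fun_eq_iff)
  ultimately show ?case
    by (simp only: subst_fm.simps sat.simps All.IH expand_simps)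
qed simp_all

text \<open>
  A term denotes an element of the universe only if its symbols belong to the signature; the
  default \<open>e 0\<close> keeps the assignment inside the universe.
\<close>

definition env :: "'a struct \<Rightarrow> (nat \<Rightarrow> 'a) \<Rightarrow> nat \<Rightarrow> 'a" where
  "env M e v = (case prod_decode v of (k, c) \<Rightarrow>
     let a = if k = 0 then e c else func M (if k = 1 then Prime c else Sym c) []
     in if a \<in> univ M then a else e 0)"

lemma range_env: "range e \<subseteq> univ M \<Longrightarrow> range (env M e) \<subseteq> univ M"
  by (auto simp: env_def Let_def image_subset_iff split: prod.splits)

lemma env_logical: "range e \<subseteq> univ M \<Longrightarrow> env M e (prod_encode (0, x)) = e x"
  by (auto simp: env_def Let_def image_subset_iff)

text \<open>\<open>env\<close> reads the constants off the structure and \<open>expand\<close> puts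
  them back. A constant of the signature denotes an element of the universe, so the default of
  \<open>env\<close> does not intervene.\<close>

lemma expand_env:
  assumes "is_struct (F, Pr) M" and "(f, length xs) \<in> F"
  shows "func (expand P N M (env M e)) f xs = func M f xs"
proof (cases xs)
  case Nil
  then have "func M f [] \<in> univ M"
    using assms by (force simp: is_struct_def)
  with Nil show ?thesis
    by (cases f) (auto simp: env_def)
qed simp

section \<open>Systems with free constants\<close>

lemma mem_signature [simp]:
  "(Sym f, n) \<in> unprimed F \<longleftrightarrow> (f, n) \<in> F" "(Prime f, n) \<notin> unprimed F"
  "(Sym f, n) \<notin> primed F" "(Prime f, n) \<in> primed F \<longleftrightarrow> (f, n) \<in> F"
  "(f, n) \<in> constants C \<longleftrightarrow> f \<in> C \<and> n = 0"
  by (auto simp: unprimed_def primed_def constants_def)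

lemma unprimed_mono: "A \<subseteq> B \<Longrightarrow> unprimed A \<subseteq> unprimed B"
  by (auto simp: unprimed_def)

lemma formula_mono:
  assumes "fst \<Pi> \<subseteq> fst \<Pi>'" and "snd \<Pi> \<subseteq> snd \<Pi>'" and "formula \<Pi> \<phi>"
  shows "formula \<Pi>' \<phi>"
proof -
  have "wf_tm (fst \<Pi>) t \<Longrightarrow> wf_tm (fst \<Pi>') t" for t
    using assms(1) by (induction t) auto
  then show ?thesis
    using assms(2,3) by (induction \<phi>) auto
qed

lemma is_struct_iff:
  "is_struct \<Pi> M \<longleftrightarrow> univ M \<noteq> {} \<and>
    (\<forall>f xs. (f, length xs) \<in> fst \<Pi> \<and> set xs \<subseteq> univ M \<longrightarrow> func M f xs \<in> univ M)"
  by (auto simp: is_struct_def)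

lemma is_struct_mono: "is_struct (F, Pr) M \<Longrightarrow> F' \<subseteq> F \<Longrightarrow> is_struct (F', Pr) M"
  unfolding is_struct_iff fst_conv by blast

lemma entailsD:
  assumes "entails TYPE('a) \<Pi> T \<phi>" and "is_struct \<Pi> (M :: 'a struct)" and "range e \<subseteq> univ M"
    and "\<And>\<psi>. \<psi> \<in> T \<Longrightarrow> sat M e \<psi>"
  shows "sat M e \<phi>"
  using assms unfolding entails_def by blast

locale free_constants =
  fixes F0 Pr :: "(nat \<times> nat) set" and T0 :: "fm set" and P N V :: "nat set"
  assumes theory_T0: "is_theory (unprimed F0, Pr) T0"
    and disjoint_P: "F0 \<inter> constants P = {}" and disjoint_N: "F0 \<inter> constants N = {}"
    and disjoint_PN: "P \<inter> N = {}"
    and constants_V: "constants V \<subseteq> F0 \<union> constants P \<union> constants N"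
begin

definition sys :: "fm \<Rightarrow> fm \<Rightarrow> system" where
  "sys \<iota> \<upsilon> = \<lparr>symbols = F0 \<union> constants P \<union> constants N, predicates = Pr, thy_axioms = T0,
     variables = V, fun_symbols = {}, init = \<iota>, update = \<upsilon>\<rparr>"

abbreviation state :: signature where
  "state \<equiv> (unprimed (F0 \<union> constants P \<union> constants N), Pr)"

abbreviation trans :: signature where
  "trans \<equiv> (unprimed (F0 \<union> constants P \<union> constants N) \<union> primed (constants V), Pr)"

lemma sys_simps [simp]:
  "state_sig (sys \<iota> \<upsilon>) = state" "trans_sig (sys \<iota> \<upsilon>) = trans" "thy_axioms (sys \<iota> \<upsilon>) = T0"
  "changing (sys \<iota> \<upsilon>) = constants V" "init (sys \<iota> \<upsilon>) = \<iota>" "update (sys \<iota> \<upsilon>) = \<upsilon>"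
  by (simp_all add: sys_def state_sig_def trans_sig_def changing_def)

lemma instances_sys:
  "(\<iota>, \<upsilon>, \<Phi>) \<in> instances sys \<longleftrightarrow> formula state \<iota> \<and> formula trans \<upsilon> \<and> formula state \<Phi>"
proof -
  have "formula (unprimed F0, Pr) \<phi> \<Longrightarrow> formula state \<phi>" for \<phi>
    by (erule formula_mono[rotated 2]) (simp_all add: unprimed_mono le_supI1)
  then have "is_theory state T0"
    using theory_T0 by (simp add: is_theory_def sentence_def)
  then show ?thesis
    using constants_V unfolding instances_def wf_system_def by (simp add: sys_def changing_def state_sig_def trans_sig_def)
qed

section \<open>The verification condition as a formula over the base signature\<close>

definition vc :: "fm \<times> fm \<times> fm \<Rightarrow> fm" where
  "vc = (\<lambda>(\<iota>, \<upsilon>, \<Phi>). Conj (Imp \<iota> \<Phi>) (Imp \<Phi> (Imp \<upsilon> (prime_fm (constants V) \<Phi>))))"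

lemma formula_trans: "formula state \<phi> \<Longrightarrow> formula trans \<phi>"
  by (erule formula_mono[rotated 2]) simp_all

lemma formula_prime_fm: "formula state \<phi> \<Longrightarrow> formula trans (prime_fm (constants V) \<phi>)"
proof -
  have "wf_tm (fst state) t \<Longrightarrow> wf_tm (fst trans) (prime_tm (constants V) t)" for t
  proof (induction t)
    case (Fn f ts)
    then show ?case by (cases f) auto
  qed simp
  then show "formula state \<phi> \<Longrightarrow> formula trans (prime_fm (constants V) \<phi>)"
    by (induction \<phi>) auto
qed

lemma formula_vc: "p \<in> instances sys \<Longrightarrow> formula trans (vc p)"
  by (cases p) (auto simp: vc_def instances_sys formula_trans formula_prime_fm simp del: prime_fm.simps)

abbreviation vcv :: "fm \<times> fm \<times> fm \<Rightarrow> fm" where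
  "vcv p \<equiv> consts_to_vars P N (vc p)"

text \<open>All symbols that \<open>trans\<close> adds to \<open>F0\<close> are nullary and become
  variables; a symbol with arguments must already belong to \<open>F0\<close>.\<close>

lemma formula_vcv:
  assumes "p \<in> instances sys"
  shows "formula (unprimed F0, Pr) (vcv p)"
proof -
  have const: "wf_tm (unprimed F0) (const_to_var P N f)" if "(f, 0) \<in> fst trans" for f
    using that by (cases f) auto
  have sym: "(f, Suc n) \<in> unprimed F0" if "(f, Suc n) \<in> fst trans" for f n
    using that by (cases f) auto
  have tm: "wf_tm (unprimed F0) (subst_tm (\<lambda>x. Var (prod_encode (0, x))) (const_to_var P N) t)"
    if "wf_tm (fst trans) t" for t
    using that
  proof (induction t)
    case (Fn f ts)
    then show ?case using const sym by (cases ts) simp_all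
  qed simp
  have "formula (unprimed F0, Pr) (consts_to_vars P N \<phi>)" if "formula trans \<phi>" for \<phi>
    using that
  proof (induction \<phi>)
    case (Eq s t)
    then show ?case using tm[of s] tm[of t] by simp
  next
    case (Pre p ts)
    then show ?case using tm by simp
  qed simp_all
  then show ?thesis
    using formula_vc[OF assms] by blast
qed

lemma is_struct_expand:
  assumes "is_struct (unprimed F0, Pr) M" and "range e \<subseteq> univ M"
  shows "is_struct trans (expand P N M e)"
proof -
  have e: "e v \<in> univ M" for v
    using assms(2) by auto
  have func: "func M f xs \<in> univ M" if "(f, length xs) \<in> unprimed F0" "set xs \<subseteq> univ M" for f xs
    using assms(1) that by (simp add: is_struct_iff)
  have "func (expand P N M e) f xs \<in> univ M"
    if "(f, length xs) \<in> fst trans" "set xs \<subseteq> univ M" for f xs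
  proof (cases f)
    case (Sym c)
    show ?thesis
    proof (cases "(c, length xs) \<in> F0")
      case True
      then have "func M f xs \<in> univ M"
        using that Sym by (intro func) auto
      then show ?thesis
        using Sym e by (cases xs) auto
    next
      case False
      then show ?thesis
        using that Sym e by auto
    qed
  next
    case (Prime c)
    then show ?thesis
      using that e by auto
  qed
  moreover have "univ M \<noteq> {}"
    using assms(1) by (simp add: is_struct_iff)
  ultimately show ?thesis
    unfolding is_struct_iff by (simp del: expand_simps(3))
qed

lemma sat_expand:
  fixes M :: "'a struct"
  assumes "sentence (unprimed F0, Pr) \<phi>"
  shows "sat (expand P N M e) e' \<phi> \<longleftrightarrow> sat M e'' \<phi>"
proof (rule sat_cong)
  show "formula (unprimed F0, Pr) \<phi>"
    using assms by (simp add: sentence_def)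
  fix f and xs :: "'a list"
  assume "(f, length xs) \<in> fst (unprimed F0, Pr)"
  then show "func (expand P N M e) f xs = func M f xs"
    using disjoint_P disjoint_N by (cases f) auto
qed (use assms in \<open>simp_all add: sentence_def\<close>)

text \<open>A constraint may mention parameters, so the expansion preserves it only if the variables
  of kind 3 carry the values that \<open>M\<close> gives to the parameters.\<close>

lemma sat_expand_params:
  fixes M :: "'a struct"
  assumes "sentence (unprimed (F0 \<union> constants P), Pr) \<phi>"
    and "\<forall>c\<in>P. e (prod_encode (3, c)) = func M (Sym c) []"
  shows "sat (expand P N M e) e' \<phi> \<longleftrightarrow> sat M e'' \<phi>"
proof (rule sat_cong)
  show "formula (unprimed (F0 \<union> constants P), Pr) \<phi>"
    using assms by (simp add: sentence_def)
  fix f and xs :: "'a list"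
  assume "(f, length xs) \<in> fst (unprimed (F0 \<union> constants P), Pr)"
  then show "func (expand P N M e) f xs = func M f xs"
    using assms(2) disjoint_P disjoint_N disjoint_PN by (cases f) auto
qed (use assms in \<open>simp_all add: sentence_def\<close>)

lemma sat_expand_env:
  assumes "formula (F, Pr) \<phi>" and "is_struct (F, Pr) M"
  shows "sat (expand P N M (env M e)) e' \<phi> \<longleftrightarrow> sat M e' \<phi>"
  by (rule sat_cong[OF assms(1)]) (simp_all add: expand_env[OF assms(2)] del: expand_simps(3))

text \<open>\<open>expand\<close> leads from assignments to structures and \<open>env\<close> back.
  The variables of kind 3 are tied to \<open>M\<close> so that \<Gamma> keeps its truth value; those
  of kinds 1 and 2 range freely, which is what makes the other constants free.\<close>

lemma inductive_invariant_under_iff: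
  assumes inst: "(\<iota>, \<upsilon>, \<Phi>) \<in> instances sys"
    and \<Gamma>: "sentence (unprimed (F0 \<union> constants P), Pr) \<Gamma>"
  shows "inductive_invariant_under TYPE('a) (sys \<iota> \<upsilon>) \<Gamma> \<Phi> \<longleftrightarrow>
    (\<forall>(M :: 'a struct) e. is_struct state M \<and> range e \<subseteq> univ M \<and> (\<forall>\<phi>\<in>T0. sat M e \<phi>) \<and>
      sat M e \<Gamma> \<and> (\<forall>c\<in>P. e (prod_encode (3, c)) = func M (Sym c) []) \<longrightarrow> sat M e (vcv (\<iota>, \<upsilon>, \<Phi>)))"
    (is "_ \<longleftrightarrow> ?rhs")
proof
  assume ind: "inductive_invariant_under TYPE('a) (sys \<iota> \<upsilon>) \<Gamma> \<Phi>"
  show ?rhs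
  proof (intro allI impI, elim conjE)
    fix M :: "'a struct" and e
    assume M: "is_struct state M" and e: "range e \<subseteq> univ M" and T0: "\<forall>\<phi>\<in>T0. sat M e \<phi>"
      and sat_\<Gamma>: "sat M e \<Gamma>" and params: "\<forall>c\<in>P. e (prod_encode (3, c)) = func M (Sym c) []"
    let ?M = "expand P N M e" and ?e = "\<lambda>x. e (prod_encode (0, x))"
    have trans: "is_struct trans ?M"
      using is_struct_mono[OF M unprimed_mono] e by (intro is_struct_expand) auto
    then have state: "is_struct state ?M"
      by (rule is_struct_mono) auto
    have range: "range ?e \<subseteq> univ ?M"
      using e by auto
    have T0': "sat ?M ?e \<phi>" if "\<phi> \<in> T0" for \<phi>
      using that T0 theory_T0 sat_expand unfolding is_theory_def by blast
    have \<Gamma>': "sat ?M ?e \<Gamma>"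
      using sat_expand_params[OF \<Gamma> params] sat_\<Gamma> by blast
    have init: "sat ?M ?e \<Phi>" if "sat ?M ?e \<iota>"
    proof (rule ccontr)
      assume "\<not> sat ?M ?e \<Phi>"
      with that T0' \<Gamma>' have "sat ?M ?e \<psi>" if "\<psi> \<in> T0 \<union> {\<Gamma>, \<iota>, Neg \<Phi>}" for \<psi>
        using \<open>\<psi> \<in> _\<close> by auto
      then show False
        using entailsD[OF _ state range, of _ Fls] ind
        unfolding inductive_invariant_under_def sys_simps by fastforce
    qed
    have update: "sat ?M ?e (prime_fm (constants V) \<Phi>)" if "sat ?M ?e \<upsilon>" "sat ?M ?e \<Phi>"
    proof (rule ccontr)
      assume "\<not> sat ?M ?e (prime_fm (constants V) \<Phi>)"
      with that T0' \<Gamma>' have "sat ?M ?e \<psi>"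
        if "\<psi> \<in> T0 \<union> {\<Gamma>, \<Phi>, \<upsilon>, Neg (prime_fm (constants V) \<Phi>)}" for \<psi>
        using \<open>\<psi> \<in> _\<close> by auto
      then show False
        using entailsD[OF _ trans range, of _ Fls] ind
        unfolding inductive_invariant_under_def sys_simps by fastforce
    qed
    have "sat ?M ?e (vc (\<iota>, \<upsilon>, \<Phi>))"
      using init update by (simp add: vc_def)
    then show "sat M e (vcv (\<iota>, \<upsilon>, \<Phi>))"
      by (simp only: sat_consts_to_vars)
  qed
next
  assume rhs: ?rhs
  have vc: "sat (expand P N M (env M e)) e (vc (\<iota>, \<upsilon>, \<Phi>))"
    if M: "is_struct state M" and e: "range e \<subseteq> univ M" and T0: "\<forall>\<phi>\<in>T0. sat M e \<phi>"
      and sat_\<Gamma>: "sat M e \<Gamma>" for M :: "'a struct" and e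
  proof -
    have "sat M (env M e) (vcv (\<iota>, \<upsilon>, \<Phi>))"
    proof (intro rhs[rule_format] conjI ballI)
      show "is_struct state M" by (fact M)
      show "range (env M e) \<subseteq> univ M" by (rule range_env[OF e])
      show "sat M (env M e) \<Gamma>"
        using sat_sentence[OF \<Gamma>] sat_\<Gamma> by blast
      show "sat M (env M e) \<phi>" if "\<phi> \<in> T0" for \<phi>
        using that T0 theory_T0 sat_sentence unfolding is_theory_def by blast
      show "env M e (prod_encode (3, c)) = func M (Sym c) []" if "c \<in> P" for c
      proof -
        have "(Sym c, 0) \<in> fst state"
          using that by simp
        then have "func M (Sym c) [] \<in> univ M"
          using M by (simp add: is_struct_iff)
        then show ?thesis
          by (simp add: env_def)
      qed
    qed
    then show ?thesis
      by (simp only: sat_consts_to_vars env_logical[OF e])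
  qed
  have state: "formula state \<iota>" "formula state \<Phi>" and trans: "formula trans \<upsilon>" "formula trans \<Phi>"
      "formula trans (prime_fm (constants V) \<Phi>)"
    using inst formula_trans formula_prime_fm by (simp_all add: instances_sys)
  show "inductive_invariant_under TYPE('a) (sys \<iota> \<upsilon>) \<Gamma> \<Phi>"
    unfolding inductive_invariant_under_def
  proof
    show "entails TYPE('a) (state_sig (sys \<iota> \<upsilon>)) (thy_axioms (sys \<iota> \<upsilon>) \<union> {\<Gamma>, init (sys \<iota> \<upsilon>), Neg \<Phi>}) Fls"
      unfolding entails_def sys_simps
    proof (intro allI impI, elim conjE)
      fix M :: "'a struct" and e
      assume M: "is_struct state M" and e: "range e \<subseteq> univ M"
        and sat: "\<forall>\<phi>\<in>T0 \<union> {\<Gamma>, \<iota>, Neg \<Phi>}. sat M e \<phi>"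
      \<comment> \<open>\<open>M\<close> need not interpret primed constants inside its universe, so
        \<open>env\<close> may alter them here. Only the first conjunct of \<open>vc\<close> is
        used, and it does not contain them.\<close>
      have "sat (expand P N M (env M e)) e (vc (\<iota>, \<upsilon>, \<Phi>))"
        using sat by (intro vc[OF M e]) auto
      then show "sat M e Fls"
        using sat state[THEN sat_expand_env[OF _ M]] by (simp add: vc_def)
    qed
    show "entails TYPE('a) (trans_sig (sys \<iota> \<upsilon>)) (thy_axioms (sys \<iota> \<upsilon>) \<union>
        {\<Gamma>, \<Phi>, update (sys \<iota> \<upsilon>), Neg (prime_fm (changing (sys \<iota> \<upsilon>)) \<Phi>)}) Fls"
      unfolding entails_def sys_simps
    proof (intro allI impI, elim conjE)
      fix M :: "'a struct" and e
      assume M: "is_struct trans M" and e: "range e \<subseteq> univ M"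
        and sat: "\<forall>\<phi>\<in>T0 \<union> {\<Gamma>, \<Phi>, \<upsilon>, Neg (prime_fm (constants V) \<Phi>)}. sat M e \<phi>"
      have "is_struct state M"
        using M by (rule is_struct_mono) auto
      then have "sat (expand P N M (env M e)) e (vc (\<iota>, \<upsilon>, \<Phi>))"
        using sat e by (intro vc) auto
      then show "sat M e Fls"
        using sat trans[THEN sat_expand_env[OF _ M]] by (simp add: vc_def)
    qed
  qed
qed

lemma inductive_invariant_iff:
  assumes inst: "(\<iota>, \<upsilon>, \<Phi>) \<in> instances sys"
  shows "inductive_invariant TYPE('a) (sys \<iota> \<upsilon>) \<Phi> \<longleftrightarrow>
    entails TYPE('a) (unprimed F0, Pr) T0 (vcv (\<iota>, \<upsilon>, \<Phi>))" (is "_ \<longleftrightarrow> ?rhs")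
proof -
  have Tru: "sentence (unprimed (F0 \<union> constants P), Pr) Tru"
    by (simp add: sentence_def)
  show ?thesis
    unfolding inductive_invariant_def inductive_invariant_under_iff[OF inst Tru]
  proof (intro iffI allI impI)
    fix M :: "'a struct" and e
    assume "?rhs" and *: "is_struct state M \<and> range e \<subseteq> univ M \<and> (\<forall>\<phi>\<in>T0. sat M e \<phi>) \<and>
      sat M e Tru \<and> (\<forall>c\<in>P. e (prod_encode (3, c)) = func M (Sym c) [])"
    moreover from * have "is_struct (unprimed F0, Pr) M"
      by (auto elim!: is_struct_mono simp: unprimed_def)
    ultimately show "sat M e (vcv (\<iota>, \<upsilon>, \<Phi>))"
      unfolding entails_def by blast
  next
    assume hyp: "\<forall>(M :: 'a struct) e. is_struct state M \<and> range e \<subseteq> univ M \<and> (\<forall>\<phi>\<in>T0. sat M e \<phi>) \<and>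
      sat M e Tru \<and> (\<forall>c\<in>P. e (prod_encode (3, c)) = func M (Sym c) []) \<longrightarrow> sat M e (vcv (\<iota>, \<upsilon>, \<Phi>))"
    show ?rhs
      unfolding entails_def
    proof (intro allI impI, elim conjE)
      fix M :: "'a struct" and e
      assume M: "is_struct (unprimed F0, Pr) M" and e: "range e \<subseteq> univ M" and T0: "\<forall>\<phi>\<in>T0. sat M e \<phi>"
      \<comment> \<open>A model over \<open>F0\<close> becomes one over \<open>state\<close> by
        interpreting the added constants through \<open>e\<close>. The tie between variables and
        parameters then holds by construction, and the translated formula has only symbols of
        \<open>F0\<close>, so it does not notice the change.\<close>
      let ?M = "expand P N M e"
      have "sat ?M e (vcv (\<iota>, \<upsilon>, \<Phi>))"
      proof (intro hyp[rule_format] conjI ballI)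
        show "is_struct state ?M"
          by (rule is_struct_mono[OF is_struct_expand[OF M e]]) auto
        show "sat ?M e \<phi>" if "\<phi> \<in> T0" for \<phi>
          using that T0 theory_T0 sat_expand unfolding is_theory_def by blast
        show "e (prod_encode (3, c)) = func ?M (Sym c) []" if "c \<in> P" for c
          using that disjoint_PN by auto
      qed (use e in auto)
      moreover have "func ?M f xs = func M f xs" if "(f, length xs) \<in> fst (unprimed F0, Pr)" for f xs
        using that disjoint_P disjoint_N by (cases f) auto
      then have "sat ?M e (vcv (\<iota>, \<upsilon>, \<Phi>)) \<longleftrightarrow> sat M e (vcv (\<iota>, \<upsilon>, \<Phi>))"
        by (intro sat_cong[OF formula_vcv[OF inst]]) (simp_all del: expand_simps(3))
      ultimately show "sat M e (vcv (\<iota>, \<upsilon>, \<Phi>))"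
        by blast
    qed
  qed
qed

text \<open>
  The result of \<open>qe\<close> may have free variables that do not represent parameters. Shifting these
  variables changes the formula iff there are any, and only then quantifiers are added.
\<close>

definition condition :: "(fm \<Rightarrow> fm) \<Rightarrow> fm \<times> fm \<times> fm \<Rightarrow> fm" where
  "condition qe p =
    (let \<chi> = qe (close_all (param P) (vcv p)); \<beta> = vars_to_params P id \<chi>
     in if fm_code \<beta> = fm_code (vars_to_params P Suc \<chi>) then \<beta> else close_all (param P) \<beta>)"

context
  fixes qe :: "fm \<Rightarrow> fm" and p :: "fm \<times> fm \<times> fm"
  assumes qe: "qe_method TYPE('a) (unprimed F0, Pr) T0 qe" and p: "p \<in> instances sys"
begin

abbreviation (input) closed where "closed \<equiv> close_all (param P) (vcv p)"

lemma formula_closed: "formula (unprimed F0, Pr) closed"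
  using formula_vcv[OF p] by (simp add: formula_close del: close.simps)

lemma qe_closed:
  "formula (unprimed F0, Pr) (qe closed)" "qfree (qe closed)"
  "entails TYPE('a) (unprimed F0, Pr) T0 (Iff closed (qe closed))"
  using qe formula_closed unfolding qe_method_def by blast+

lemma sentence_condition: "sentence (unprimed (F0 \<union> constants P), Pr) (condition qe p)"
proof -
  have "formula (unprimed (F0 \<union> constants P), Pr) (condition qe p)"
    using formula_vars_to_params[OF qe_closed(1)]
    by (simp add: condition_def Let_def formula_close del: close.simps)
  moreover have "fv (condition qe p) = {}"
  proof (cases "fm_code (vars_to_params P id (qe closed)) = fm_code (vars_to_params P Suc (qe closed))")
    case True
    then have "fv (qe closed) \<subseteq> Collect (param P)"
      using vars_to_params_eq_iff[OF qe_closed(2)] fm_code_inject by blast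
    from fv_vars_to_params[OF qe_closed(2) this] True show ?thesis
      by (simp add: condition_def Let_def del: close.simps)
  next
    case False
    then show ?thesis
      using fv_vars_to_params_subset[OF qe_closed(2), of P]
      by (auto simp: condition_def Let_def fv_close_all simp del: close.simps)
  qed
  ultimately show ?thesis
    by (simp add: sentence_def)
qed

text \<open>The free variables of \<open>closed\<close> all stand for parameters. If
  \<open>qe\<close> adds none, both images coincide and the branch that adds quantifiers is not
  taken.\<close>

lemma qfree_condition:
  assumes "fv (qe closed) \<subseteq> fv closed"
  shows "qfree (condition qe p)"
proof -
  have "fv (qe closed) \<subseteq> Collect (param P)"
    using assms unfolding fv_close_all by blast
  then have "vars_to_params P id (qe closed) = vars_to_params P Suc (qe closed)"
    using vars_to_params_eq_iff[OF qe_closed(2)] by blast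
  then show ?thesis
    using qfree_vars_to_params[OF qe_closed(2)]
    by (simp add: condition_def Let_def del: close.simps)
qed

lemma sat_condition:
  fixes M :: "'a struct"
  assumes M: "is_struct state M" and e: "range e \<subseteq> univ M" and T0: "\<forall>\<phi>\<in>T0. sat M e \<phi>"
  shows "sat M e (condition qe p) \<longleftrightarrow>
    (\<forall>e'. range e' \<subseteq> univ M \<and> (\<forall>c\<in>P. e' (prod_encode (3, c)) = func M (Sym c) []) \<longrightarrow>
      sat M e' (vcv p))" (is "_ \<longleftrightarrow> ?rhs")
proof -
  let ?\<beta> = "vars_to_params P id (qe closed)"
  \<comment> \<open>The right-hand side does not depend on \<open>e'\<close>. So the formula has the
    same truth value under all assignments, and closing it in the second branch does not change its
    meaning.\<close>
  have \<beta>: "sat M e' ?\<beta> \<longleftrightarrow> ?rhs" if e': "range e' \<subseteq> univ M" for e'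
  proof -
    \<comment> \<open>The assignment produced by \<open>sat_vars_to_params\<close>: parameter
      variables take their values from \<open>M\<close>, all others from \<open>e'\<close>.\<close>
    let ?e = "\<lambda>v. if param P v then func M (Sym (snd (prod_decode v))) [] else e' (id v)"
    have "func M (Sym c) [] \<in> univ M" if "c \<in> P" for c
      using M that by (simp add: is_struct_iff)
    then have range: "range ?e \<subseteq> univ M"
      using e' by (auto simp: param_def)
    have params:  "(\<forall>i. param P i \<longrightarrow> e'' i = ?e i) \<longleftrightarrow>
        (\<forall>c\<in>P. e'' (prod_encode (3, c)) = func M (Sym c) [])" for e'' :: "nat \<Rightarrow> 'a"
    proof
      assume "\<forall>i. param P i \<longrightarrow> e'' i = ?e i"
      then show "\<forall>c\<in>P. e'' (prod_encode (3, c)) = func M (Sym c) []"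
        by (simp add: param_def)
    next
      assume par: "\<forall>c\<in>P. e'' (prod_encode (3, c)) = func M (Sym c) []"
      show "\<forall>i. param P i \<longrightarrow> e'' i = ?e i"
      proof (intro allI impI)
        fix i assume i: "param P i"
        then have "prod_encode (3, snd (prod_decode i)) = i"
          unfolding param_def by (metis prod.collapse prod_decode_inverse)
        with i par show "e'' i = ?e i"
          by (metis param_def)
      qed
    qed
    have M0: "is_struct (unprimed F0, Pr) M"
      by (rule is_struct_mono[OF M unprimed_mono]) auto
    have "sat M ?e (Iff closed (qe closed))"
    proof (rule entailsD[OF qe_closed(3) M0 range])
      show "sat M ?e \<phi>" if "\<phi> \<in> T0" for \<phi>
        using that T0 theory_T0 sat_sentence unfolding is_theory_def by blast
    qed
    then have "sat M e' ?\<beta> \<longleftrightarrow> sat M ?e closed"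
      unfolding sat_vars_to_params[OF qe_closed(2)] sat.simps by blast
    also have "\<dots> \<longleftrightarrow> (\<forall>e''. range e'' \<subseteq> univ M \<and> (\<forall>i. param P i \<longrightarrow> e'' i = ?e i) \<longrightarrow>
        sat M e'' (vcv p))"
      by (rule sat_close_all[OF formula_vcv[OF p] range])
    finally show ?thesis
      unfolding params .
  qed
  show ?thesis
  proof (cases "fm_code ?\<beta> = fm_code (vars_to_params P Suc (qe closed))")
    case True
    then have "condition qe p = ?\<beta>"
      by (simp add: condition_def Let_def del: close.simps)
    then show ?thesis
      using \<beta>[OF e] by simp
  next
    case False
    then have cond: "condition qe p = close_all (param P) ?\<beta>"
      by (simp add: condition_def Let_def del: close.simps)
    have "sat M e (condition qe p) \<longleftrightarrow>
        (\<forall>e'. range e' \<subseteq> univ M \<and> (\<forall>i. param P i \<longrightarrow> e' i = e i) \<longrightarrow> sat M e' ?\<beta>)"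
      unfolding cond by (rule sat_close_all[OF formula_vars_to_params[OF qe_closed(1)] e])
    also have "\<dots> \<longleftrightarrow> ?rhs"
      using \<beta> e by blast
    finally show ?thesis .
  qed
qed

end

text \<open>\<open>condition\<close> internalizes the quantifier over assignments in
  \<open>inductive_invariant_under_iff\<close>. As the axioms and \<Gamma> are sentences, they
  survive every change of assignment, so this quantifier can be moved inside each model.\<close>

lemma weakest_condition:
  assumes qe: "qe_method TYPE('a) (unprimed F0, Pr) T0 qe" and p: "(\<iota>, \<upsilon>, \<Phi>) \<in> instances sys"
  shows "weakest_condition TYPE('a) (unprimed (F0 \<union> constants P), Pr) (sys \<iota> \<upsilon>) \<Phi>
    (condition qe (\<iota>, \<upsilon>, \<Phi>))"
  unfolding weakest_condition_def
proof (intro conjI allI impI)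
  show "sentence (unprimed (F0 \<union> constants P), Pr) (condition qe (\<iota>, \<upsilon>, \<Phi>))"
    by (rule sentence_condition[OF qe p])
  fix \<Gamma> assume \<Gamma>: "sentence (unprimed (F0 \<union> constants P), Pr) \<Gamma>"
  show "inductive_invariant_under TYPE('a) (sys \<iota> \<upsilon>) \<Gamma> \<Phi> \<longleftrightarrow>
    entails TYPE('a) (state_sig (sys \<iota> \<upsilon>)) (thy_axioms (sys \<iota> \<upsilon>) \<union> {\<Gamma>}) (condition qe (\<iota>, \<upsilon>, \<Phi>))"
    unfolding inductive_invariant_under_iff[OF p \<Gamma>] sys_simps
  proof (intro iffI allI impI; (elim conjE)?)
    assume ind: "\<forall>(M :: 'a struct) e. is_struct state M \<and> range e \<subseteq> univ M \<and> (\<forall>\<phi>\<in>T0. sat M e \<phi>) \<and>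
      sat M e \<Gamma> \<and> (\<forall>c\<in>P. e (prod_encode (3, c)) = func M (Sym c) []) \<longrightarrow> sat M e (vcv (\<iota>, \<upsilon>, \<Phi>))"
    show "entails TYPE('a) state (T0 \<union> {\<Gamma>}) (condition qe (\<iota>, \<upsilon>, \<Phi>))"
      unfolding entails_def
    proof (intro allI impI, elim conjE)
      fix M :: "'a struct" and e
      assume M: "is_struct state M" and e: "range e \<subseteq> univ M" and sat: "\<forall>\<phi>\<in>T0 \<union> {\<Gamma>}. sat M e \<phi>"
      have "sat M e' (vcv (\<iota>, \<upsilon>, \<Phi>))"
        if "range e' \<subseteq> univ M" "\<forall>c\<in>P. e' (prod_encode (3, c)) = func M (Sym c) []" for e'
      proof (intro ind[rule_format] conjI M that(1) ballI)
        show "sat M e' \<phi>" if "\<phi> \<in> T0" for \<phi>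
          using that sat theory_T0 sat_sentence unfolding is_theory_def by blast
        show "sat M e' \<Gamma>"
          using sat sat_sentence[OF \<Gamma>] by blast
      qed (use that(2) in blast)
      then show "sat M e (condition qe (\<iota>, \<upsilon>, \<Phi>))"
        using sat by (subst sat_condition[OF qe p M e]) auto
    qed
  next
    fix M :: "'a struct" and e
    assume ent: "entails TYPE('a) state (T0 \<union> {\<Gamma>}) (condition qe (\<iota>, \<upsilon>, \<Phi>))"
      and M: "is_struct state M" and e: "range e \<subseteq> univ M" and T0: "\<forall>\<phi>\<in>T0. sat M e \<phi>"
      and \<Gamma>: "sat M e \<Gamma>" and params: "\<forall>c\<in>P. e (prod_encode (3, c)) = func M (Sym c) []"
    have "sat M e (condition qe (\<iota>, \<upsilon>, \<Phi>))"
      using T0 \<Gamma> by (intro entailsD[OF ent M e]) auto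
    then show "sat M e (vcv (\<iota>, \<upsilon>, \<Phi>))"
      using sat_condition[OF qe p M e T0] e params by blast
  qed
qed

section \<open>Computability of the reduction and of the condition\<close>

lemma computable_on_vcv:
  assumes "decidable_set Or P" and "decidable_set Or N" and "decidable_set Or V"
  shows "computable_on Or instance_code fm_code D vcv"
proof -
  have "computable_on Or instance_code fm_code D (\<lambda>p. fst p)"
    unfolding computable_on_def
    by (rule exI[of _ "\<lambda>n. fst (prod_decode n)"]) (auto intro: recursive_in.left)
  moreover have "computable_on Or instance_code fm_code D (\<lambda>p. fst (snd p))"
    unfolding computable_on_def
    by (rule exI[of _ "\<lambda>n. fst (prod_decode (snd (prod_decode n)))"])
      (auto intro!: recursive_in_intros)
  moreover have "computable_on Or instance_code fm_code D (\<lambda>p. snd (snd p))"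
    unfolding computable_on_def
    by (rule exI[of _ "\<lambda>n. snd (prod_decode (snd (prod_decode n)))"])
      (auto intro!: recursive_in_intros)
  ultimately have "computable_on Or instance_code fm_code D vc"
    unfolding vc_def case_prod_beta
    by (intro computable_on_Imp computable_on_Fls computable_on_prime_fm[OF assms(3)])
  then show ?thesis
    by (rule computable_on_consts_to_vars[OF assms(1,2)])
qed

lemma computable_on_condition:
  assumes "decidable_set Or P" and "decidable_set Or N" and "decidable_set Or V"
    and qe: "computable_on Or fm_code fm_code {\<phi>. formula (unprimed F0, Pr) \<phi>} qe"
  shows "computable_on Or instance_code fm_code (instances sys) (condition qe)"
proof -
  have "computable_on Or instance_code fm_code (instances sys) (\<lambda>p. close_all (param P) (vcv p))"
    by (intro computable_on_close_all recursive_in_param computable_on_vcv assms)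
  then have "computable_on Or instance_code fm_code (instances sys)
      (\<lambda>p. qe (close_all (param P) (vcv p)))"
    by (rule computable_on_comp[OF _ qe])
      (use formula_vcv in \<open>auto simp: formula_close simp del: close.simps\<close>)
  moreover have "recursive_in Or id"
    using recursive_in_id by (simp add: id_def)
  moreover have "recursive_in Or Suc"
    by (rule recursive_in.suc)
  ultimately show ?thesis
    unfolding condition_def Let_def
    by (intro computable_on_if_code_eq computable_on_close_all recursive_in_param
        computable_on_vars_to_params assms)
qed

lemma decidable_on_inductive_invariant:
  assumes "decidable_set Or P" and "decidable_set Or N" and "decidable_set Or V"
    and qe: "qe_method TYPE('a) (unprimed F0, Pr) T0 qe"
    and qe_comp: "computable_on Or fm_code fm_code {\<phi>. formula (unprimed F0, Pr) \<phi>} qe"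
    and dec: "decidable_on Or fm_code {\<phi>. formula (unprimed F0, Pr) \<phi> \<and> qfree \<phi>}
      (entails TYPE('a) (unprimed F0, Pr) T0)"
  shows "decidable_on Or instance_code (instances sys)
    (\<lambda>(\<iota>, \<upsilon>, \<Phi>). inductive_invariant TYPE('a) (sys \<iota> \<upsilon>) \<Phi>)"
proof -
  have qe_vcv: "formula (unprimed F0, Pr) (qe (vcv p))" "qfree (qe (vcv p))"
      "entails TYPE('a) (unprimed F0, Pr) T0 (Iff (vcv p) (qe (vcv p)))" if "p \<in> instances sys" for p
    using qe formula_vcv[OF that] unfolding qe_method_def by blast+
  have "computable_on Or instance_code fm_code (instances sys) (\<lambda>p. qe (vcv p))"
    by (rule computable_on_comp[OF computable_on_vcv[OF assms(1-3)] qe_comp])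
      (use formula_vcv in auto)
  then have "computable_on Or instance_code of_bool (instances sys)
      (\<lambda>p. entails TYPE('a) (unprimed F0, Pr) T0 (qe (vcv p)))"
    by (rule computable_on_comp[OF _ dec[unfolded decidable_on_def]]) (use qe_vcv in auto)
  moreover have "entails TYPE('a) (unprimed F0, Pr) T0 (qe (vcv (\<iota>, \<upsilon>, \<Phi>))) \<longleftrightarrow>
      inductive_invariant TYPE('a) (sys \<iota> \<upsilon>) \<Phi>" if "(\<iota>, \<upsilon>, \<Phi>) \<in> instances sys" for \<iota> \<upsilon> \<Phi>
    unfolding inductive_invariant_iff[OF that]
    using qe_vcv(3)[OF that] unfolding entails_def sat.simps by blast
  ultimately show ?thesis
    unfolding decidable_on_def by (elim computable_on_cong[rotated]) auto
qed

end

theorem theorem9: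
  fixes \<Sigma>0 Pred \<Sigma>S \<Sigma> :: "(nat \<times> nat) set"
    and T0 TS :: "fm set"
    and \<Sigma>P \<Sigma>n V :: "nat set"
    and S :: "fm \<Rightarrow> fm \<Rightarrow> system"
    and qe :: "fm \<Rightarrow> fm"
    and Or :: "(nat \<Rightarrow> nat) set"
  defines "S \<equiv> \<lambda>Init Update.
    \<lparr>symbols = \<Sigma>S, predicates = Pred, thy_axioms = TS,
     variables = V, fun_symbols = \<Sigma>, init = Init, update = Update\<rparr>"
  assumes "\<Sigma> = {}"
    and "constants V \<subseteq> \<Sigma>S"
    and "is_theory (unprimed \<Sigma>0, Pred) T0"
    and "\<Sigma>S = \<Sigma>0 \<union> constants \<Sigma>P \<union> constants \<Sigma>n"
    and "\<Sigma>0 \<inter> constants \<Sigma>P = {}" and "\<Sigma>0 \<inter> constants \<Sigma>n = {}" and "\<Sigma>P \<inter> \<Sigma>n = {}"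
    and "TS = T0"
    and "decidable_set Or \<Sigma>P" and "decidable_set Or \<Sigma>n" and "decidable_set Or V"
    and "qe_method TYPE('a) (unprimed \<Sigma>0, Pred) T0 qe"
    and "computable_on Or fm_code fm_code {\<phi>. formula (unprimed \<Sigma>0, Pred) \<phi>} qe"
  shows
    "(decidable_on Or fm_code {\<phi>. formula (unprimed \<Sigma>0, Pred) \<phi> \<and> qfree \<phi>}
        (entails TYPE('a) (unprimed \<Sigma>0, Pred) T0)
      \<longrightarrow> decidable_on Or instance_code (instances S)
            (\<lambda>(Init, Update, \<Phi>). inductive_invariant TYPE('a) (S Init Update) \<Phi>))
     \<and>
     (\<exists>G. computable_on Or instance_code fm_code (instances S) G \<and>
        (\<forall>(Init, Update, \<Phi>) \<in> instances S.
           weakest_condition TYPE('a) (unprimed (\<Sigma>0 \<union> constants \<Sigma>P), Pred)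
             (S Init Update) \<Phi> (G (Init, Update, \<Phi>)) \<and>
           ((\<forall>\<phi>. formula (unprimed \<Sigma>0, Pred) \<phi> \<longrightarrow> fv (qe \<phi>) \<subseteq> fv \<phi>)
              \<longrightarrow> qfree (G (Init, Update, \<Phi>)))))"
proof -
  interpret free_constants \<Sigma>0 Pred T0 \<Sigma>P \<Sigma>n V
    using assms by unfold_locales auto
  have S: "S = sys"
    using assms by (simp add: fun_eq_iff sys_def)
  note dec = \<open>decidable_set Or \<Sigma>P\<close> \<open>decidable_set Or \<Sigma>n\<close> \<open>decidable_set Or V\<close>
  note qe = \<open>qe_method TYPE('a) (unprimed \<Sigma>0, Pred) T0 qe\<close>
  note comp = \<open>computable_on Or fm_code fm_code {\<phi>. formula (unprimed \<Sigma>0, Pred) \<phi>} qe\<close>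
  show ?thesis
    unfolding S
  proof (intro conjI impI exI[of _ "condition qe"] ballI)
    show "decidable_on Or instance_code (instances sys)
        (\<lambda>(Init, Update, \<Phi>). inductive_invariant TYPE('a) (sys Init Update) \<Phi>)"
      if "decidable_on Or fm_code {\<phi>. formula (unprimed \<Sigma>0, Pred) \<phi> \<and> qfree \<phi>}
        (entails TYPE('a) (unprimed \<Sigma>0, Pred) T0)"
      by (rule decidable_on_inductive_invariant[OF dec qe comp that])
    show "computable_on Or instance_code fm_code (instances sys) (condition qe)"
      by (rule computable_on_condition[OF dec comp])
    fix p assume p: "p \<in> instances sys"
    have "qfree (condition qe p)" if "\<forall>\<phi>. formula (unprimed \<Sigma>0, Pred) \<phi> \<longrightarrow> fv (qe \<phi>) \<subseteq> fv \<phi>"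
      using that formula_closed[OF qe p] by (intro qfree_condition[OF qe p]) blast
    then show "case p of (Init, Update, \<Phi>) \<Rightarrow>
        weakest_condition TYPE('a) (unprimed (\<Sigma>0 \<union> constants \<Sigma>P), Pred) (sys Init Update) \<Phi>
          (condition qe (Init, Update, \<Phi>)) \<and>
        ((\<forall>\<phi>. formula (unprimed \<Sigma>0, Pred) \<phi> \<longrightarrow> fv (qe \<phi>) \<subseteq> fv \<phi>) \<longrightarrow>
          qfree (condition qe (Init, Update, \<Phi>)))"
      using weakest_condition[OF qe] p by (auto split: prod.split)
  qed
qed

end
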